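(* Let $D=2r+1\ge3$ be odd, let $n\ge D+1$, and let $M=n-2r-2$. Consider all spiders with $n$ vertices and diameter $D$. (i) If $M=0$, the unique such spider is the path $P_{D+1}$. (ii) Assume $M\ge1$. For each integer $q$ with $\lceil M/r\rceil\le q\le M$, write $M=qc+t$ with $0\le t<q$. Then $$\max\{\lambda_2(T): T\text{ a spider},\ \operatorname{diam}(T)=D,\ |V(T)|=n\}=\max_{\lceil M/r\rceil\le q\le M}\lambda_2(\mathrm{AS}(r,q+2,c,t)).$$ For each fixed such $q$, the unique (up to isomorphism) spider maximizing $\lambda_2$ among spiders with $n$ vertices, diameter $D$ and exactly $q+2$ branches is $\mathrm{AS}(r,q+2,c,t)$, where $M=qc+t$, $0\le t<q$. Its first nonzero Steklov eigenvalue is the unique root $\lambda\in\left(\frac1{r+1},\frac1r\right)$ of $$\frac1{1-(r+1)\lambda}+\frac1{1-r\lambda}+\frac{t}{1-(c+1)\lambda}+\frac{q-t}{1-c\lambda}=0.$$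
   Context: For integers $b\ge2$ and $\ell_1,\dots,\ell_b\ge1$, the spider $S(\ell_1,\dots,\ell_b)$ is the tree obtained by taking $b$ paths (branches) of lengths $\ell_1,\dots,\ell_b$ and identifying one endpoint of each into a single common vertex, the paths being otherwise disjoint. For integers $r\ge1$, $b\ge2$, $c\ge1$, $0\le t\le b-2$, $\mathrm{AS}(r,b,c,t)$ is the spider with branches of lengths $r+1$, $r$, $t$ branches of length $c+1$ and $b-2-t$ branches of length $c$. For a tree $T=(V,E)$ with leaf set $\delta\Omega$, the harmonic extension $\widehat g$ of $g\colon\delta\Omega\to\mathbb R$ is the unique function on $V$ equal to $g$ on $\delta\Omega$ with $\sum_{w\sim v}(\widehat g(v)-\widehat g(w))=0$ at every non-leaf $v$, and $\lambda_2(T)=\min\{\sum_{xy\in E}(\widehat g(x)-\widehat g(y))^2/\sum_\omega g(\omega)^2: g\ne0,\ \sum_\omega g(\omega)=0\}$ is the first nonzero Steklov eigenvalue. $P_m$ is the path on $m$ vertices. *)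

theory Defs
  imports
    Complex_Main
    "HOL-Library.FuncSet"
    "HOL-Library.Infinite_Typeclass"
begin

record 'a ugraph =
  verts :: "'a set"
  edges :: "'a set set"

definition simple_graph :: "'a ugraph \<Rightarrow> bool" where
  "simple_graph G \<longleftrightarrow>
     finite (verts G) \<and> (\<forall>e\<in>edges G. e \<subseteq> verts G \<and> card e = 2)"

definition adj :: "'a ugraph \<Rightarrow> 'a \<Rightarrow> 'a \<Rightarrow> bool" where
  "adj G u v \<longleftrightarrow> {u, v} \<in> edges G"

definition nbrs :: "'a ugraph \<Rightarrow> 'a \<Rightarrow> 'a set" where
  "nbrs G v = {w \<in> verts G. adj G v w}"

definition leaves :: "'a ugraph \<Rightarrow> 'a set" where
  "leaves G = {v \<in> verts G. card (nbrs G v) = 1}"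

text \<open>The relation power \<open>adj G ^^ k\<close> holds between the ends of a walk with \<open>k\<close> edges.
  Distance and diameter are only meaningful for connected graphs; spiders are connected.\<close>

definition graph_dist :: "'a ugraph \<Rightarrow> 'a \<Rightarrow> 'a \<Rightarrow> nat" where
  "graph_dist G u v = (LEAST k. (adj G ^^ k) u v)"

definition diameter :: "'a ugraph \<Rightarrow> nat" where
  "diameter G = Max {graph_dist G u v | u v. u \<in> verts G \<and> v \<in> verts G}"

definition graph_iso :: "'a ugraph \<Rightarrow> 'b ugraph \<Rightarrow> bool" (infix "\<simeq>" 50) where
  "G \<simeq> H \<longleftrightarrow>
     (\<exists>f. bij_betw f (verts G) (verts H) \<and>
          (\<forall>u\<in>verts G. \<forall>v\<in>verts G. adj G u v \<longleftrightarrow> adj H (f u) (f v)))"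

definition path_graph :: "nat \<Rightarrow> nat ugraph" where
  "path_graph m = \<lparr>verts = {..<m}, edges = {{i, Suc i} | i. Suc i < m}\<rparr>"

text \<open>\<open>(i, j)\<close> is the vertex at distance \<open>j\<close> from the centre on the \<open>i\<close>-th branch; the
  endpoints \<open>j = 0\<close> of all branches are identified.\<close>

definition spider_vertex :: "nat \<Rightarrow> nat \<Rightarrow> nat \<times> nat" where
  "spider_vertex i j = (if j = 0 then (0, 0) else (i, j))"

definition spider :: "nat list \<Rightarrow> (nat \<times> nat) ugraph" where
  "spider ls =
     \<lparr>verts = {spider_vertex i j | i j. i < length ls \<and> j \<le> ls ! i},
      edges = {{spider_vertex i j, spider_vertex i (Suc j)} | i j. i < length ls \<and> j < ls ! i}\<rparr>"

definition AS :: "nat \<Rightarrow> nat \<Rightarrow> nat \<Rightarrow> nat \<Rightarrow> (nat \<times> nat) ugraph" where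
  "AS r b c t = spider ([r + 1, r] @ replicate t (c + 1) @ replicate (b - 2 - t) c)"

definition spider_with :: "nat \<Rightarrow> 'a ugraph \<Rightarrow> bool" where
  "spider_with b T \<longleftrightarrow>
     simple_graph T \<and> b \<ge> 2 \<and>
     (\<exists>ls. length ls = b \<and> (\<forall>l\<in>set ls. l \<ge> 1) \<and> T \<simeq> spider ls)"

definition spiders :: "nat \<Rightarrow> nat \<Rightarrow> 'a ugraph set" where
  "spiders n D = {T. (\<exists>b. spider_with b T) \<and> card (verts T) = n \<and> diameter T = D}"

definition spiders_br :: "nat \<Rightarrow> nat \<Rightarrow> nat \<Rightarrow> 'a ugraph set" where
  "spiders_br n D b = {T. spider_with b T \<and> card (verts T) = n \<and> diameter T = D}"

text \<open>A boundary function is represented by a function on the whole vertex type of which only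
  the values on the leaves matter. Extensionality (a fixed value outside the vertex set) makes
  the harmonic extension unique as a total function.\<close>

definition harmonic_extension :: "'a ugraph \<Rightarrow> ('a \<Rightarrow> real) \<Rightarrow> 'a \<Rightarrow> real" where
  "harmonic_extension T g =
     (THE h. h \<in> extensional (verts T) \<and>
             (\<forall>v\<in>leaves T. h v = g v) \<and>
             (\<forall>v\<in>verts T - leaves T. (\<Sum>w\<in>nbrs T v. h v - h w) = 0))"

text \<open>The sum runs over ordered pairs, so every edge is counted twice; hence the factor
  one half.\<close>

definition energy :: "'a ugraph \<Rightarrow> ('a \<Rightarrow> real) \<Rightarrow> real" where
  "energy T f = (\<Sum>x\<in>verts T. \<Sum>y\<in>nbrs T x. (f x - f y)\<^sup>2) / 2"

definition is_maximum :: "real \<Rightarrow> real set \<Rightarrow> bool" where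
  "is_maximum m A \<longleftrightarrow> m \<in> A \<and> (\<forall>x\<in>A. x \<le> m)"

text \<open>\<open>LEAST\<close> on the reals denotes the minimum (not merely the infimum) of the set of
  Rayleigh quotients.\<close>

definition steklov_lambda2 :: "'a ugraph \<Rightarrow> real" where
  "steklov_lambda2 T =
     (LEAST x. x \<in> {energy T (harmonic_extension T g) / (\<Sum>w\<in>leaves T. (g w)\<^sup>2) | g.
                     (\<exists>w\<in>leaves T. g w \<noteq> 0) \<and> (\<Sum>w\<in>leaves T. g w) = 0})"

end

theory Submission
  imports Defs "HOL-Combinatorics.List_Permutation"
begin

text \<open>Harmonic functions on a spider are linear along the branches, so the Rayleigh quotient only
  involves the value at the centre and the slopes of the branches. If the two longest branches have
  lengths \<open>a1 > a2\<close>, the first nonzero Steklov eigenvalue is the root in \<open>(1 / a1, 1 / a2)\<close> of the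
  secular function, the sum of \<open>1 / (1 - l * x)\<close> over all branch lengths \<open>l\<close>, which is strictly
  increasing there. At the eigenvalue of \<open>AS\<close>, the secular function of a competing
  spider is nonnegative: among the short branches by discrete convexity of \<open>1 / (1 - l * x)\<close> in
  \<open>l\<close>, and for the two longest ones because their sum is fixed. Hence the competitor has a smaller
  eigenvalue unless its multiset of branch lengths is the same.\<close>

subsection \<open>Graph isomorphisms\<close>

text \<open>Parity makes the comparison possible. Two longest branches with odd total
  \<open>2 * r + 1\<close> satisfy \<open>a2 \<le> r\<close> and \<open>r + 1 \<le> a1\<close>, so
  the interval between the poles \<open>1 / a1\<close> and \<open>1 / a2\<close> contains the one
  between \<open>1 / (r + 1)\<close> and \<open>1 / r\<close>. The eigenvalue of \<open>AS\<close>
  can therefore be inserted into the secular function of every competitor. There only the longest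
  branch has a negative term. This one sign identifies the root with the minimal quotient, but it
  also puts the longest branch beyond the pole of \<open>l \<mapsto> 1 / (1 - l * x)\<close>, where
  convexity is lost; the two longest branches need an explicit computation instead. The range of
  \<open>q\<close> expresses that \<open>q\<close> further branches of lengths between 1 and
  \<open>r\<close> have total length \<open>M\<close>. Two obstacles shape the graph part. The
  harmonic extension is a definite description, so unique solvability must be available before
  anything is carried along an isomorphism. And the competitors live on an arbitrary infinite type
  while \<open>AS\<close> lives on pairs of naturals, so the maximum is attained only by an
  isomorphic copy of \<open>AS\<close>.\<close>

lemma graph_iso_refl: "G \<simeq> G"
  unfolding graph_iso_def by (rule exI[of _ id]) auto

text \<open>Keeps the vertex map explicit, so that boundary data and harmonic functions can be
  pulled back along it and along its inverse.\<close>

definition iso_map :: "('a \<Rightarrow> 'b) \<Rightarrow> 'a ugraph \<Rightarrow> 'b ugraph \<Rightarrow> bool" where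
  "iso_map f G H \<longleftrightarrow> bij_betw f (verts G) (verts H) \<and>
     (\<forall>u\<in>verts G. \<forall>v\<in>verts G. adj G u v \<longleftrightarrow> adj H (f u) (f v))"

lemma graph_iso_iff_iso_map: "G \<simeq> H \<longleftrightarrow> (\<exists>f. iso_map f G H)"
  by (simp add: graph_iso_def iso_map_def)

lemma iso_map_inv_into:
  assumes "iso_map f G H" shows "iso_map (inv_into (verts G) f) H G"
proof -
  let ?g = "inv_into (verts G) f"
  have f: "bij_betw f (verts G) (verts H)"
    and a: "\<And>u v. u \<in> verts G \<Longrightarrow> v \<in> verts G \<Longrightarrow> adj G u v \<longleftrightarrow> adj H (f u) (f v)"
    using assms unfolding iso_map_def by blast+
  have g: "bij_betw ?g (verts H) (verts G)" using f by (rule bij_betw_inv_into)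
  have "adj H u v \<longleftrightarrow> adj G (?g u) (?g v)" if "u \<in> verts H" "v \<in> verts H" for u v
    using a[OF bij_betw_apply[OF g that(1)] bij_betw_apply[OF g that(2)]] that
    by (simp add: bij_betw_inv_into_right[OF f])
  thus ?thesis unfolding iso_map_def using g by blast
qed

lemma graph_iso_sym: "G \<simeq> H \<Longrightarrow> H \<simeq> G"
  unfolding graph_iso_iff_iso_map using iso_map_inv_into by blast

lemma graph_iso_trans:
  assumes "G \<simeq> H" "H \<simeq> K" shows "G \<simeq> K"
proof -
  obtain f where f: "bij_betw f (verts G) (verts H)"
    and a: "\<And>u v. u \<in> verts G \<Longrightarrow> v \<in> verts G \<Longrightarrow> adj G u v \<longleftrightarrow> adj H (f u) (f v)"
    using assms unfolding graph_iso_def by blast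
  obtain g where g: "bij_betw g (verts H) (verts K)"
    and b: "\<And>u v. u \<in> verts H \<Longrightarrow> v \<in> verts H \<Longrightarrow> adj H u v \<longleftrightarrow> adj K (g u) (g v)"
    using assms unfolding graph_iso_def by blast
  have "bij_betw (g \<circ> f) (verts G) (verts K)" using f g by (rule bij_betw_trans)
  moreover have "adj G u v \<longleftrightarrow> adj K ((g \<circ> f) u) ((g \<circ> f) v)"
    if "u \<in> verts G" "v \<in> verts G" for u v
    using a[OF that] b[OF bij_betw_apply[OF f that(1)] bij_betw_apply[OF f that(2)]] by simp
  ultimately show ?thesis unfolding graph_iso_def by blast
qed

lemma graph_iso_card: "G \<simeq> H \<Longrightarrow> card (verts G) = card (verts H)"
  unfolding graph_iso_def using bij_betw_same_card by blast

lemma simple_graph_adj_verts: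
  "simple_graph G \<Longrightarrow> adj G u v \<Longrightarrow> u \<in> verts G \<and> v \<in> verts G"
  unfolding simple_graph_def adj_def by auto

text \<open>Edges of a simple graph have both ends in \<open>verts\<close>, so a walk never leaves
  the set on which \<open>f\<close> is controlled. Assuming one implication on adjacency allows the
  use with an isomorphism and with its inverse.\<close>

lemma walk_image:
  assumes "simple_graph G"
    and a: "\<forall>u\<in>verts G. \<forall>v\<in>verts G. adj G u v \<longrightarrow> adj H (f u) (f v)"
    and "(adj G ^^ k) u v"
  shows "(adj H ^^ k) (f u) (f v)"
  using assms(3)
proof (induction k arbitrary: v)
  case 0 then show ?case by simp
next
  case (Suc k)
  then obtain w where w: "(adj G ^^ k) u w" "adj G w v" by auto
  then show ?case using Suc.IH[OF w(1)] a simple_graph_adj_verts[OF assms(1) w(2)] by auto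
qed

lemma graph_iso_diameter:
  assumes "G \<simeq> H" "simple_graph G" "simple_graph H"
  shows "diameter G = diameter H"
proof -
  obtain f where iso: "iso_map f G H" using assms(1) graph_iso_iff_iso_map by blast
  let ?g = "inv_into (verts G) f"
  have f: "bij_betw f (verts G) (verts H)"
    and a: "\<forall>u\<in>verts G. \<forall>v\<in>verts G. adj G u v \<longrightarrow> adj H (f u) (f v)"
    using iso unfolding iso_map_def by blast+
  have b: "\<forall>u\<in>verts H. \<forall>v\<in>verts H. adj H u v \<longrightarrow> adj G (?g u) (?g v)"
    using iso_map_inv_into[OF iso] unfolding iso_map_def by blast
  have walk: "(adj G ^^ k) u v \<longleftrightarrow> (adj H ^^ k) (f u) (f v)"
    if "u \<in> verts G" "v \<in> verts G" for k u v
  proof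
    show "(adj H ^^ k) (f u) (f v)" if "(adj G ^^ k) u v"
      using walk_image[OF assms(2) a that] .
    assume "(adj H ^^ k) (f u) (f v)"
    from walk_image[OF assms(3) b this] show "(adj G ^^ k) u v"
      using that f by (simp add: bij_betw_def)
  qed
  have dist: "graph_dist G u v = graph_dist H (f u) (f v)"
    if "u \<in> verts G" "v \<in> verts G" for u v
    unfolding graph_dist_def using walk[OF that] by simp
  have "{graph_dist G u v | u v. u \<in> verts G \<and> v \<in> verts G}
      = (\<lambda>(u, v). graph_dist G u v) ` (verts G \<times> verts G)" by auto
  also have "\<dots> = (\<lambda>(u, v). graph_dist H (f u) (f v)) ` (verts G \<times> verts G)"
    using dist by (intro image_cong) auto
  also have "\<dots> = (\<lambda>(u, v). graph_dist H u v) ` (f ` verts G \<times> f ` verts G)"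
    by force
  also have "\<dots> = {graph_dist H u v | u v. u \<in> verts H \<and> v \<in> verts H}"
    using f by (auto simp: bij_betw_def)
  finally show ?thesis unfolding diameter_def by simp
qed

text \<open>Moves a concrete spider on pairs of naturals to an arbitrary vertex type: an infinite
  type has finite subsets of every size.\<close>

lemma graph_iso_copy:
  fixes S :: "'b ugraph"
  assumes "simple_graph S"
  shows "\<exists>T :: 'a::infinite ugraph. simple_graph T \<and> T \<simeq> S"
proof -
  have fin: "finite (verts S)" using assms by (simp add: simple_graph_def)
  obtain B :: "'a set" where B: "finite B" "card B = card (verts S)"
    using infinite_arbitrarily_large[OF infinite_UNIV] by blast
  then obtain f where f: "bij_betw f (verts S) B"
    using fin finite_same_card_bij by metis
  hence inj: "inj_on f (verts S)" by (simp add: bij_betw_def)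
  define T where "T = \<lparr>verts = f ` verts S, edges = (\<lambda>e. f ` e) ` edges S\<rparr>"
  have "simple_graph T"
    using assms inj fin unfolding simple_graph_def T_def
    by (auto simp: card_image inj_on_subset)
  moreover have "S \<simeq> T"
    unfolding graph_iso_def
  proof (intro exI[of _ f] conjI ballI)
    show "bij_betw f (verts S) (verts T)" using inj by (simp add: T_def bij_betw_def)
    fix u v assume uv: "u \<in> verts S" "v \<in> verts S"
    have "f ` {u, v} \<in> (\<lambda>e. f ` e) ` edges S \<longleftrightarrow> {u, v} \<in> edges S"
    proof
      assume "f ` {u, v} \<in> (\<lambda>e. f ` e) ` edges S"
      then obtain e where e: "e \<in> edges S" "f ` {u, v} = f ` e" by blast
      have "e \<subseteq> verts S" using e assms by (simp add: simple_graph_def)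
      hence "{u, v} = e" using e(2) uv inj inj_on_image_eq_iff by (metis empty_subsetI insert_subset)
      thus "{u, v} \<in> edges S" using e by simp
    qed blast
    thus "adj S u v \<longleftrightarrow> adj T (f u) (f v)" by (simp add: adj_def T_def)
  qed
  ultimately show ?thesis using graph_iso_sym by blast
qed

subsection \<open>Isomorphism invariance of the Steklov eigenvalue\<close>

definition is_harmonic :: "'a ugraph \<Rightarrow> ('a \<Rightarrow> real) \<Rightarrow> ('a \<Rightarrow> real) \<Rightarrow> bool" where
  "is_harmonic T g h \<longleftrightarrow> h \<in> extensional (verts T) \<and>
     (\<forall>v\<in>leaves T. h v = g v) \<and>
     (\<forall>v\<in>verts T - leaves T. (\<Sum>w\<in>nbrs T v. h v - h w) = 0)"

text \<open>Exactly what makes the \<open>THE\<close> in \<open>harmonic_extension\<close>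
  meaningful for all boundary data.\<close>

definition uniquely_harmonic :: "'a ugraph \<Rightarrow> bool" where
  "uniquely_harmonic T \<longleftrightarrow> (\<forall>g. \<exists>!h. is_harmonic T g h)"

lemma harmonic_extension_eq:
  "uniquely_harmonic T \<Longrightarrow> is_harmonic T g h \<Longrightarrow> harmonic_extension T g = h"
  unfolding uniquely_harmonic_def harmonic_extension_def is_harmonic_def[symmetric]
  by (metis the_equality)

definition rayleigh_quotients :: "'a ugraph \<Rightarrow> real set" where
  "rayleigh_quotients T =
     {energy T (harmonic_extension T g) / (\<Sum>w\<in>leaves T. (g w)\<^sup>2) | g.
        (\<exists>w\<in>leaves T. g w \<noteq> 0) \<and> (\<Sum>w\<in>leaves T. g w) = 0}"

lemma steklov_lambda2_eqI:
  "m \<in> rayleigh_quotients T \<Longrightarrow> (\<And>x. x \<in> rayleigh_quotients T \<Longrightarrow> m \<le> x) \<Longrightarrow>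
     steklov_lambda2 T = m"
  unfolding steklov_lambda2_def rayleigh_quotients_def[symmetric] by (rule Least_equality)

context
  fixes f :: "'a \<Rightarrow> 'b" and G H
  assumes iso: "iso_map f G H"
begin

lemma iso_map_inj: "inj_on f (verts G)"
  and iso_map_verts: "verts H = f ` verts G"
  using iso by (auto simp: iso_map_def bij_betw_def)

lemma iso_map_nbrs:
  assumes "v \<in> verts G" shows "nbrs H (f v) = f ` nbrs G v"
  using assms iso unfolding nbrs_def iso_map_verts iso_map_def by blast

lemma iso_map_inj_nbrs: "inj_on f (nbrs G v)"
  using iso_map_inj by (rule inj_on_subset) (auto simp: nbrs_def)

lemma iso_map_leaves: "leaves H = f ` leaves G"
proof -
  have "card (nbrs H (f v)) = card (nbrs G v)" if "v \<in> verts G" for v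
    using iso_map_nbrs[OF that] card_image[OF iso_map_inj_nbrs] by simp
  thus ?thesis unfolding leaves_def iso_map_verts by auto
qed

lemma iso_map_inj_leaves: "inj_on f (leaves G)"
  using iso_map_inj by (rule inj_on_subset) (auto simp: leaves_def)

text \<open>Harmonic functions pull back against the direction of \<open>f\<close>. The
  \<open>restrict\<close> restores the fixed value outside the vertex set that extensionality
  demands.\<close>

lemma iso_map_harmonic:
  assumes "is_harmonic H g h"
  shows "is_harmonic G (g \<circ> f) (restrict (h \<circ> f) (verts G))"
  unfolding is_harmonic_def
proof (intro conjI ballI)
  fix v assume "v \<in> leaves G"
  moreover from this have "v \<in> verts G" by (simp add: leaves_def)
  moreover have "h (f v) = g (f v)" 
    using assms iso_map_leaves \<open>v \<in> leaves G\<close> by (auto simp: is_harmonic_def)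
  ultimately show "restrict (h \<circ> f) (verts G) v = (g \<circ> f) v" by simp
next
  fix v assume v: "v \<in> verts G - leaves G"
  hence "f v \<in> verts H - leaves H"
    using iso_map_inj unfolding iso_map_verts iso_map_leaves
    by (auto simp: leaves_def inj_on_def)
  hence "(\<Sum>w\<in>nbrs H (f v). h (f v) - h w) = 0" using assms by (simp add: is_harmonic_def)
  hence "(\<Sum>w\<in>nbrs G v. h (f v) - h (f w)) = 0"
    using v by (simp add: iso_map_nbrs sum.reindex[OF iso_map_inj_nbrs])
  moreover have "(\<Sum>w\<in>nbrs G v. restrict (h \<circ> f) (verts G) v - restrict (h \<circ> f) (verts G) w)
     = (\<Sum>w\<in>nbrs G v. h (f v) - h (f w))"
    using v by (intro sum.cong) (auto simp: nbrs_def)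
  ultimately show "(\<Sum>w\<in>nbrs G v. restrict (h \<circ> f) (verts G) v - restrict (h \<circ> f) (verts G) w) = 0"
    by simp
qed simp

lemma iso_map_energy: "energy G (restrict (h \<circ> f) (verts G)) = energy H h"
proof -
  have "(\<Sum>x\<in>verts H. \<Sum>y\<in>nbrs H x. (h x - h y)\<^sup>2) =
     (\<Sum>x\<in>verts G. \<Sum>y\<in>nbrs H (f x). (h (f x) - h y)\<^sup>2)"
    unfolding iso_map_verts by (simp add: sum.reindex[OF iso_map_inj])
  also have "\<dots> = (\<Sum>x\<in>verts G. \<Sum>y\<in>nbrs G x. (h (f x) - h (f y))\<^sup>2)"
    by (intro sum.cong refl) (simp add: iso_map_nbrs sum.reindex[OF iso_map_inj_nbrs])
  also have "\<dots> = (\<Sum>x\<in>verts G. \<Sum>y\<in>nbrs G x.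
      (restrict (h \<circ> f) (verts G) x - restrict (h \<circ> f) (verts G) y)\<^sup>2)"
    by (intro sum.cong refl) (auto simp: nbrs_def)
  finally show ?thesis by (simp add: energy_def)
qed

text \<open>One inclusion suffices, since the inverse isomorphism supplies the other.\<close>

lemma iso_map_rayleigh_quotients:
  assumes "uniquely_harmonic G" "uniquely_harmonic H"
  shows "rayleigh_quotients H \<subseteq> rayleigh_quotients G"
proof
  fix x assume "x \<in> rayleigh_quotients H"
  then obtain g where x: "x = energy H (harmonic_extension H g) / (\<Sum>w\<in>leaves H. (g w)\<^sup>2)"
    and g: "\<exists>w\<in>leaves H. g w \<noteq> 0" "(\<Sum>w\<in>leaves H. g w) = 0"
    unfolding rayleigh_quotients_def by blast
  obtain h where h: "is_harmonic H g h" using assms(2) unfolding uniquely_harmonic_def by blast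
  have "harmonic_extension H g = h" using assms(2) h by (rule harmonic_extension_eq)
  moreover have "harmonic_extension G (g \<circ> f) = restrict (h \<circ> f) (verts G)"
    using assms(1) iso_map_harmonic[OF h] by (rule harmonic_extension_eq)
  ultimately have "x = energy G (harmonic_extension G (g \<circ> f)) / (\<Sum>w\<in>leaves G. ((g \<circ> f) w)\<^sup>2)"
    unfolding x iso_map_leaves
    by (simp add: iso_map_energy[unfolded o_def] o_def sum.reindex[OF iso_map_inj_leaves])
  moreover have "\<exists>w\<in>leaves G. (g \<circ> f) w \<noteq> 0" "(\<Sum>w\<in>leaves G. (g \<circ> f) w) = 0"
    using g unfolding iso_map_leaves by (auto simp: sum.reindex[OF iso_map_inj_leaves])
  ultimately show "x \<in> rayleigh_quotients G" unfolding rayleigh_quotients_def by blast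
qed

end

lemma is_harmonic_cong:
  "(\<And>v. v \<in> leaves T \<Longrightarrow> g v = g' v) \<Longrightarrow> is_harmonic T g h \<longleftrightarrow> is_harmonic T g' h"
  by (simp add: is_harmonic_def)

text \<open>Existence comes from solving on \<open>H\<close> and pulling back along
  \<open>f\<close>; uniqueness from pulling any solution on \<open>G\<close> back along the inverse,
  where it must be the one on \<open>H\<close>.\<close>

lemma graph_iso_uniquely_harmonic:
  assumes "G \<simeq> H" "uniquely_harmonic H"
  shows "uniquely_harmonic G"
  unfolding uniquely_harmonic_def
proof
  fix g :: "'a \<Rightarrow> real"
  obtain f where f: "iso_map f G H" using assms(1) graph_iso_iff_iso_map by blast
  let ?f' = "inv_into (verts G) f"
  note f' = iso_map_inv_into[OF f]
  have inj: "inj_on f (verts G)" using f by (rule iso_map_inj)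
  obtain h where h: "is_harmonic H (g \<circ> ?f') h"
    using assms(2) unfolding uniquely_harmonic_def by blast
  have "is_harmonic G ((g \<circ> ?f') \<circ> f) (restrict (h \<circ> f) (verts G))"
    using iso_map_harmonic[OF f h] .
  \<comment> \<open>The boundary data went to \<open>H\<close> and back. They agree with
    \<open>g\<close> only on vertices, which is enough because only leaf values enter.\<close>
  hence "is_harmonic G g (restrict (h \<circ> f) (verts G))"
    by (subst is_harmonic_cong[where g' = "(g \<circ> ?f') \<circ> f"]) (use inj in \<open>auto simp: leaves_def\<close>)
  moreover have "h1 = restrict (h \<circ> f) (verts G)" if "is_harmonic G g h1" for h1
  proof -
    have "is_harmonic H (g \<circ> ?f') (restrict (h1 \<circ> ?f') (verts H))"
      using iso_map_harmonic[OF f' that] .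
    hence eq: "restrict (h1 \<circ> ?f') (verts H) = h"
      using h assms(2) unfolding uniquely_harmonic_def by blast
    have ext: "h1 \<in> extensional (verts G)" using that by (simp add: is_harmonic_def)
    show ?thesis
    proof (rule extensionalityI[OF ext])
      fix v assume "v \<in> verts G"
      thus "h1 v = restrict (h \<circ> f) (verts G) v"
        unfolding eq[symmetric] using inj f by (simp add: iso_map_verts[OF f])
    qed simp
  qed
  ultimately show "\<exists>!h. is_harmonic G g h" by blast
qed

lemma graph_iso_steklov_lambda2:
  assumes "G \<simeq> H" "uniquely_harmonic H"
  shows "steklov_lambda2 G = steklov_lambda2 H"
proof -
  have uG: "uniquely_harmonic G" using assms by (rule graph_iso_uniquely_harmonic)
  obtain f where f: "iso_map f G H" using assms(1) graph_iso_iff_iso_map by blast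
  have "rayleigh_quotients G = rayleigh_quotients H"
    using iso_map_rayleigh_quotients[OF f uG assms(2)]
      iso_map_rayleigh_quotients[OF iso_map_inv_into[OF f] assms(2) uG] by blast
  thus ?thesis unfolding steklov_lambda2_def rayleigh_quotients_def by simp
qed

subsection \<open>Vertices, neighbours and diameter of spiders\<close>

lemma graph_dist_le: "(adj G ^^ k) u v \<Longrightarrow> graph_dist G u v \<le> k"
  unfolding graph_dist_def by (rule Least_le)

locale spider_lengths =
  fixes ls :: "nat list"
  assumes two_branches: "2 \<le> length ls"
    and lengths_pos: "l \<in> set ls \<Longrightarrow> 1 \<le> l"
begin

abbreviation "S \<equiv> spider ls"
abbreviation "b \<equiv> length ls"

lemma nth_pos: "i < b \<Longrightarrow> 0 < ls ! i"
  using lengths_pos[of "ls ! i"] by simp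

text \<open>In the defining comprehension the centre arises once from every branch. Here each vertex
  is listed once, so sums over vertices split into the centre and the branches.\<close>

lemma verts_spider: "verts S = insert (0, 0) (SIGMA i:{..<b}. {1..ls ! i})"
proof (intro equalityI subsetI)
  fix x assume "x \<in> verts S"
  thus "x \<in> insert (0, 0) (SIGMA i:{..<b}. {1..ls ! i})"
    by (auto simp: spider_def spider_vertex_def split: if_splits)
next
  fix x assume x: "x \<in> insert (0, 0) (SIGMA i:{..<b}. {1..ls ! i})"
  then obtain i j where "x = spider_vertex i j" "i < b" "j \<le> ls ! i"
  proof (cases "x = (0, 0)")
    case True
    thus ?thesis using that[of 0 0] two_branches by (cases ls) (auto simp: spider_vertex_def)
  next
    case False
    then obtain i j where "x = (i, j)" "i < b" "1 \<le> j" "j \<le> ls ! i" using x by auto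
    thus ?thesis using that[of i j] by (simp add: spider_vertex_def)
  qed
  thus "x \<in> verts S" by (auto simp: spider_def)
qed

lemma spider_vertex_mem: "i < b \<Longrightarrow> j \<le> ls ! i \<Longrightarrow> spider_vertex i j \<in> verts S"
  by (auto simp: spider_def)

lemma finite_verts_spider: "finite (verts S)"
  by (simp add: verts_spider)

lemma sum_verts_spider:
  fixes f :: "nat \<times> nat \<Rightarrow> 'c::comm_monoid_add"
  shows "(\<Sum>v\<in>verts S. f v) = f (0, 0) + (\<Sum>i<b. \<Sum>j=1..ls ! i. f (i, j))"
  unfolding verts_spider by (subst sum.insert) (auto simp: sum.Sigma)

lemma card_verts_spider: "card (verts S) = Suc (sum_list ls)"
  unfolding card_eq_sum sum_verts_spider by (simp add: sum_list_sum_nth atLeast0LessThan)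

lemma adj_spider_iff:
  "adj S u v \<longleftrightarrow> (\<exists>i<b. \<exists>j<ls ! i.
     (u = spider_vertex i j \<and> v = spider_vertex i (Suc j)) \<or>
     (v = spider_vertex i j \<and> u = spider_vertex i (Suc j)))"
  unfolding adj_def spider_def by (auto simp: doubleton_eq_iff)

lemma adj_spiderI:
  assumes "i < b" "j < ls ! i"
  shows "adj S (spider_vertex i j) (spider_vertex i (Suc j))"
    and "adj S (spider_vertex i (Suc j)) (spider_vertex i j)"
  unfolding adj_spider_iff using assms by blast+

lemma adj_spiderE:
  assumes "adj S u v"
  obtains i j where "i < b" "j < ls ! i" "u = spider_vertex i j" "v = spider_vertex i (Suc j)"
    | i j where "i < b" "j < ls ! i" "v = spider_vertex i j" "u = spider_vertex i (Suc j)"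
  using assms unfolding adj_spider_iff by blast

lemma simple_graph_spider: "simple_graph S"
  unfolding simple_graph_def
proof (intro conjI ballI)
  fix e assume "e \<in> edges S"
  then obtain i j where e: "e = {spider_vertex i j, spider_vertex i (Suc j)}" "i < b" "j < ls ! i"
    by (auto simp: spider_def)
  show "e \<subseteq> verts S" using e spider_vertex_mem[of i j] spider_vertex_mem[of i "Suc j"] by simp
  show "card e = 2" using e by (auto simp: spider_vertex_def)
qed (rule finite_verts_spider)

lemma nbrs_center: "nbrs S (0, 0) = (\<lambda>i. (i, 1)) ` {..<b}"
proof (intro equalityI subsetI)
  fix w assume "w \<in> nbrs S (0, 0)"
  thus "w \<in> (\<lambda>i. (i, 1)) ` {..<b}"
    by (auto simp: nbrs_def adj_spider_iff spider_vertex_def split: if_splits)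
next
  fix w :: "nat \<times> nat" assume "w \<in> (\<lambda>i. (i, 1)) ` {..<b}"
  then obtain i where i: "i < b" "w = (i, 1)" by auto
  have "adj S (0, 0) w"
    using adj_spiderI(1)[of i 0] i nth_pos[OF i(1)] by (simp add: spider_vertex_def)
  thus "w \<in> nbrs S (0, 0)" using simple_graph_adj_verts[OF simple_graph_spider]
    by (auto simp: nbrs_def)
qed

lemma nbrs_branch:
  assumes "i < b" "Suc j \<le> ls ! i"
  shows "nbrs S (i, Suc j) =
    insert (spider_vertex i j) (if Suc (Suc j) \<le> ls ! i then {(i, Suc (Suc j))} else {})"
    (is "_ = ?R")
proof (intro equalityI subsetI)
  fix w assume "w \<in> nbrs S (i, Suc j)"
  thus "w \<in> ?R"
    by (auto simp: nbrs_def adj_spider_iff spider_vertex_def split: if_splits)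
next
  fix w assume "w \<in> ?R"
  then consider "w = spider_vertex i j" | "w = (i, Suc (Suc j))" "Suc (Suc j) \<le> ls ! i"
    by (auto split: if_splits)
  hence "adj S (i, Suc j) w"
  proof cases
    case 1
    thus ?thesis using adj_spiderI(2)[of i j] assms by (simp add: spider_vertex_def)
  next
    case 2
    thus ?thesis using adj_spiderI(1)[of i "Suc j"] assms by (simp add: spider_vertex_def)
  qed
  thus "w \<in> nbrs S (i, Suc j)" using simple_graph_adj_verts[OF simple_graph_spider]
    by (auto simp: nbrs_def)
qed

lemma leaves_spider: "leaves S = (\<lambda>i. (i, ls ! i)) ` {..<b}"
proof -
  have "card (nbrs S (0, 0)) = b" unfolding nbrs_center
    by (simp add: card_image inj_on_def)
  \<comment> \<open>With two or more branches the centre is not a leaf.\<close>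
  hence c: "(0, 0) \<notin> leaves S" using two_branches by (simp add: leaves_def)
  have br: "(i, Suc j) \<in> leaves S \<longleftrightarrow> Suc j = ls ! i" if "i < b" "Suc j \<le> ls ! i" for i j
    using that spider_vertex_mem[of i "Suc j"]
    by (auto simp: leaves_def nbrs_branch[OF that] spider_vertex_def)
  show ?thesis
  proof (intro equalityI subsetI)
    fix v assume v: "v \<in> leaves S"
    hence "v \<in> verts S" "v \<noteq> (0, 0)" using c by (auto simp: leaves_def)
    then obtain i j where "v = (i, Suc j)" "i < b" "Suc j \<le> ls ! i"
      unfolding verts_spider by (auto simp: gr0_conv_Suc Suc_le_eq)
    thus "v \<in> (\<lambda>i. (i, ls ! i)) ` {..<b}" using v br by auto
  next
    fix v assume "v \<in> (\<lambda>i. (i, ls ! i)) ` {..<b}"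
    then obtain i where i: "i < b" "v = (i, ls ! i)" by auto
    moreover obtain j where "ls ! i = Suc j" using nth_pos[OF i(1)] by (auto simp: gr0_conv_Suc)
    ultimately show "v \<in> leaves S" using br[of i j] by simp
  qed
qed

lemma sum_leaves_spider:
  "(\<Sum>v\<in>leaves S. f v) = (\<Sum>i<b. f (i, ls ! i))"
  unfolding leaves_spider by (subst sum.reindex) (auto simp: inj_on_def)

lemma interior_spider:
  "verts S - leaves S = insert (0, 0) {(i, Suc j) | i j. i < b \<and> Suc j < ls ! i}" (is "_ = ?R")
proof (intro equalityI subsetI)
  fix v assume v: "v \<in> verts S - leaves S"
  show "v \<in> ?R"
  proof (cases "v = (0, 0)")
    case False
    then obtain i j where ij: "v = (i, j)" "i < b" "1 \<le> j" "j \<le> ls ! i"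
      using v unfolding verts_spider by auto
    moreover have "j \<noteq> ls ! i" using v ij unfolding leaves_spider by auto
    ultimately show ?thesis by (cases j) auto
  qed simp
next
  fix v assume "v \<in> ?R"
  thus "v \<in> verts S - leaves S"
    unfolding verts_spider leaves_spider using nth_pos by fastforce
qed

lemma adj_sym: "adj S u v \<Longrightarrow> adj S v u"
  by (simp add: adj_def insert_commute)

lemma walk_along_branch:
  assumes "i < b" "j + k \<le> ls ! i"
  shows "(adj S ^^ k) (spider_vertex i j) (spider_vertex i (j + k))"
  using assms(2)
proof (induction k)
  case (Suc k)
  have "adj S (spider_vertex i (j + k)) (spider_vertex i (j + Suc k))"
    using adj_spiderI(1)[of i "j + k"] Suc.prems assms(1) by simp
  thus ?case using Suc by auto
qed simp

lemma walk_rev: "(adj S ^^ k) u v \<Longrightarrow> (adj S ^^ k) v u"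
proof (induction k arbitrary: v)
  case (Suc k)
  then obtain w where "(adj S ^^ k) u w" "adj S w v" by auto
  thus ?case using Suc.IH[of w] adj_sym relpowp_Suc_I2 by metis
qed simp

lemma walk_to_center:
  assumes "i < b" "j \<le> ls ! i"
  shows "(adj S ^^ j) (spider_vertex i j) (0, 0)"
  using walk_rev[OF walk_along_branch[of i 0 j]] assms by (simp add: spider_vertex_def)

end

text \<open>The signed distance to the centre, counted negatively on all branches but the first,
  changes by one along every edge, so it bounds distances from below.\<close>

lemma diameter_spider:
  assumes "spider_lengths (a1 # a2 # ms)" and "a2 \<le> a1" and "\<And>m. m \<in> set ms \<Longrightarrow> m \<le> a2"
  shows "diameter (spider (a1 # a2 # ms)) = a1 + a2"
proof -
  interpret spider_lengths "a1 # a2 # ms" by fact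
  have le2: "(a1 # a2 # ms) ! i \<le> a2" if that: "i < b" "i \<noteq> 0" for i
  proof -
    obtain k where k: "i = Suc k" using \<open>i \<noteq> 0\<close> not0_implies_Suc by blast
    hence "k < length (a2 # ms)" using that by simp
    hence "(a2 # ms) ! k \<in> set (a2 # ms)" by (rule nth_mem)
    thus ?thesis unfolding k using assms(3) by auto
  qed
  have le1: "(a1 # a2 # ms) ! i \<le> a1" if "i < b" for i
    using le2[OF that] assms(2) by (cases "i = 0") auto
  have upper: "graph_dist S u v \<le> a1 + a2" if uv: "u \<in> verts S" "v \<in> verts S" for u v
  proof -
    obtain i j where u: "u = spider_vertex i j" "i < b" "j \<le> (a1 # a2 # ms) ! i"
      using uv(1) unfolding spider_def by auto
    obtain i' j' where v: "v = spider_vertex i' j'" "i' < b" "j' \<le> (a1 # a2 # ms) ! i'"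
      using uv(2) unfolding spider_def by auto
    show ?thesis
    proof (cases "i = i'")
      case True
      have "\<exists>k\<le>a1. (adj S ^^ k) u v"
      proof (cases "j \<le> j'")
        case jj: True
        have "(adj S ^^ (j' - j)) u v"
          using walk_along_branch[of i j "j' - j"] u v True jj by simp
        thus ?thesis using v le1[of i'] by (intro exI[of _ "j' - j"]) auto
      next
        case jj: False
        have "(adj S ^^ (j - j')) u v"
          using walk_rev[OF walk_along_branch[of i j' "j - j'"]] u v True jj by simp
        thus ?thesis using u le1[of i] by (intro exI[of _ "j - j'"]) auto
      qed
      thus ?thesis using graph_dist_le[of _ S u v] by (meson le_trans le_add1)
    next
      case False
      have "(adj S ^^ (j + j')) u v"
        unfolding relpowp_add using walk_to_center[OF u(2,3)] walk_rev[OF walk_to_center[OF v(2,3)]]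
          u(1) v(1) by auto
      hence "graph_dist S u v \<le> j + j'" by (rule graph_dist_le)
      moreover have "j + j' \<le> a1 + a2"
        using False u(3) v(3) le1[OF u(2)] le1[OF v(2)] le2[OF u(2)] le2[OF v(2)]
        by (cases "i = 0") linarith+
      ultimately show ?thesis by simp
    qed
  qed
  define s :: "nat \<times> nat \<Rightarrow> int" where "s = (\<lambda>(i, j). if i = 0 then int j else - int j)"
  have step: "\<bar>s u - s v\<bar> \<le> 1" if "adj S u v" for u v
    using that unfolding adj_spider_iff by (auto simp: s_def spider_vertex_def)
  have lip: "\<bar>s u - s v\<bar> \<le> int k" if "(adj S ^^ k) u v" for u v k
    using that
  proof (induction k arbitrary: v)
    case (Suc k)
    then obtain w where "(adj S ^^ k) u w" "adj S w v" by auto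
    thus ?case using Suc.IH[of w] step[of w v] by simp
  qed simp
  have "graph_dist S (0, a1) (1, a2) = a1 + a2"
  proof (rule antisym)
    have m: "(0, a1) \<in> verts S" "(1, a2) \<in> verts S"
      using nth_pos[of 0] nth_pos[of 1] by (auto simp: verts_spider)
    thus "graph_dist S (0, a1) (1, a2) \<le> a1 + a2" by (rule upper)
    have "(adj S ^^ (a1 + a2)) (0, a1) (1, a2)"
      unfolding relpowp_add
      using walk_to_center[of 0 a1] walk_rev[OF walk_to_center[of 1 a2]]
        nth_pos[of 0] nth_pos[of 1] by (auto simp: spider_vertex_def)
    hence "(adj S ^^ graph_dist S (0, a1) (1, a2)) (0, a1) (1, a2)"
      unfolding graph_dist_def by (rule LeastI)
    from lip[OF this] show "a1 + a2 \<le> graph_dist S (0, a1) (1, a2)"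
      by (simp add: s_def)
  qed
  moreover have "(0, a1) \<in> verts S" "(1, a2) \<in> verts S"
    using nth_pos[of 0] nth_pos[of 1] by (auto simp: verts_spider)
  ultimately have "a1 + a2 \<in> {graph_dist S u v | u v. u \<in> verts S \<and> v \<in> verts S}"
    by (metis (mono_tags, lifting) mem_Collect_eq)
  moreover have "finite {graph_dist S u v | u v. u \<in> verts S \<and> v \<in> verts S}"
    by (rule finite_subset[of _ "{..a1 + a2}"]) (use upper in auto)
  ultimately show ?thesis
    unfolding diameter_def by (intro Max_eqI) (use upper in blast)+
qed

subsection \<open>Isomorphisms between spiders\<close>

lemma spider_iso_permutation:
  assumes "spider_lengths ls" and "mset ls = mset ls'"
  shows "spider ls \<simeq> spider ls'"
proof -
  interpret A: spider_lengths ls by fact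
  interpret B: spider_lengths ls'
    using A.two_branches A.lengths_pos mset_eq_length[OF assms(2)] mset_eq_setD[OF assms(2)]
    by unfold_locales auto
  obtain p where p: "bij_betw p {..<length ls} {..<length ls'}"
    and nth: "\<And>i. i < length ls \<Longrightarrow> ls ! i = ls' ! p i"
    using permutation_Ex_bij[OF assms(2)] by blast
  have inj: "p i = p i' \<longleftrightarrow> i = i'" if "i < length ls" "i' < length ls" for i i'
    using p that by (auto simp: bij_betw_def inj_on_def)
  have pless: "p i < length ls'" if "i < length ls" for i
    using p that bij_betw_apply by fastforce
  have surj: "\<exists>i<length ls. p i = k" if "k < length ls'" for k
    using p that unfolding bij_betw_def by (metis imageE lessThan_iff)
  \<comment> \<open>Going through \<open>spider_vertex\<close> fixes the centre even if
    \<open>p\<close> moves branch 0.\<close>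
  define f where "f = (\<lambda>(i, j). spider_vertex (p i) j)"
  have fsv: "f (spider_vertex i j) = spider_vertex (p i) j" for i j
    by (simp add: f_def spider_vertex_def)
  have sv_eq: "spider_vertex i j = spider_vertex i' j' \<longleftrightarrow> j = j' \<and> (j = 0 \<or> i = i')" for i j i' j'
    by (auto simp: spider_vertex_def)
  have "bij_betw f (verts (spider ls)) (verts (spider ls'))"
    unfolding bij_betw_def
  proof
    show "inj_on f (verts (spider ls))"
    proof (rule inj_onI)
      fix u v assume "u \<in> verts (spider ls)" "v \<in> verts (spider ls)" and eq: "f u = f v"
      then obtain i j i' j' where "u = spider_vertex i j" "i < length ls"
        "v = spider_vertex i' j'" "i' < length ls" unfolding spider_def by auto
      thus "u = v" using eq inj by (auto simp: fsv sv_eq)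
    qed
    show "f ` verts (spider ls) = verts (spider ls')"
    proof (intro equalityI subsetI)
      fix w assume "w \<in> f ` verts (spider ls)"
      then obtain i j where "w = f (spider_vertex i j)" "i < length ls" "j \<le> ls ! i"
        unfolding spider_def by auto
      thus "w \<in> verts (spider ls')" using nth[of i] pless[of i] B.spider_vertex_mem[of "p i" j]
        by (simp add: fsv)
    next
      fix w assume "w \<in> verts (spider ls')"
      then obtain k j where k: "w = spider_vertex k j" "k < length ls'" "j \<le> ls' ! k"
        unfolding spider_def by auto
      obtain i where i: "i < length ls" "p i = k" using surj[OF k(2)] by blast
      have "w = f (spider_vertex i j)" using k i by (simp add: fsv)
      moreover have "spider_vertex i j \<in> verts (spider ls)"
        using A.spider_vertex_mem[of i j] nth[of i] i k by simp
      ultimately show "w \<in> f ` verts (spider ls)" by blast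
    qed
  qed
  moreover have "adj (spider ls) u v \<longleftrightarrow> adj (spider ls') (f u) (f v)"
    if uv: "u \<in> verts (spider ls)" "v \<in> verts (spider ls)" for u v
  proof
    assume "adj (spider ls) u v"
    thus "adj (spider ls') (f u) (f v)"
      by (rule A.adj_spiderE) (auto simp: fsv nth pless intro!: B.adj_spiderI)
  next
    have key: "x = spider_vertex i j"
      if "x \<in> verts (spider ls)" "f x = spider_vertex (p i) j" "i < length ls" for x i j
      using that inj unfolding spider_def by (auto simp: fsv sv_eq)
    have lift: "\<exists>i<length ls. x = spider_vertex i j \<and> y = spider_vertex i (Suc j) \<and> j < ls ! i"
      if "x \<in> verts (spider ls)" "y \<in> verts (spider ls)" "k < length ls'" "j < ls' ! k"
        "f x = spider_vertex k j" "f y = spider_vertex k (Suc j)" for x y k j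
    proof -
      have "\<exists>i<length ls. p i = k" using that(3) by (rule surj)
      then obtain i where i: "i < length ls" "p i = k" by blast
      show ?thesis
        using i nth[OF i(1)] key[OF that(1) _ i(1)] key[OF that(2) _ i(1)] that(4-6) by auto
    qed
    assume "adj (spider ls') (f u) (f v)"
    thus "adj (spider ls) u v"
    proof (rule B.adj_spiderE)
      fix k j assume "k < length ls'" "j < ls' ! k"
        "f u = spider_vertex k j" "f v = spider_vertex k (Suc j)"
      from lift[OF uv this] show ?thesis using A.adj_spiderI by blast
    next
      fix k j assume "k < length ls'" "j < ls' ! k"
        "f v = spider_vertex k j" "f u = spider_vertex k (Suc j)"
      from lift[OF uv(2,1) this] show ?thesis using A.adj_spiderI by blast
    qed
  qed
  ultimately show ?thesis unfolding graph_iso_def by blast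
qed

lemma path_graph_iso_spider:
  assumes "1 \<le> a" "1 \<le> c"
  shows "path_graph (a + c + 1) \<simeq> spider [a, c]"
proof -
  interpret spider_lengths "[a, c]" using assms by unfold_locales auto
  \<comment> \<open>Positions \<open>0\<close> to \<open>a\<close> of the path run along branch 0
    from its leaf to the centre, the later ones out along branch 1.\<close>
  define f where "f k = (if k \<le> a then spider_vertex 0 (a - k) else spider_vertex 1 (k - a))" for k
  have lt2: "i < b \<longleftrightarrow> i = 0 \<or> i = 1" for i by auto
  have inj: "inj_on f {..<a + c + 1}"
    by (auto simp: inj_on_def f_def spider_vertex_def split: if_splits)
  have "f ` {..<a + c + 1} = verts S"
  proof (rule card_subset_eq[OF finite_verts_spider])
    show "f ` {..<a + c + 1} \<subseteq> verts S"
      using spider_vertex_mem[of 0] spider_vertex_mem[of 1] by (auto simp: f_def)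
    show "card (f ` {..<a + c + 1}) = card (verts S)"
      using card_image[OF inj] card_verts_spider by simp
  qed
  hence "bij_betw f (verts (path_graph (a + c + 1))) (verts S)"
    using inj by (simp add: bij_betw_def path_graph_def)
  moreover have "adj (path_graph (a + c + 1)) u v \<longleftrightarrow> adj S (f u) (f v)"
    if uv: "u \<in> verts (path_graph (a + c + 1))" "v \<in> verts (path_graph (a + c + 1))" for u v
  proof -
    have less: "u < a + c + 1" "v < a + c + 1" using uv by (auto simp: path_graph_def)
    have "adj (path_graph (a + c + 1)) u v \<longleftrightarrow> v = Suc u \<or> u = Suc v"
      using less unfolding adj_def path_graph_def by (auto simp: doubleton_eq_iff)
    also have "\<dots> \<longleftrightarrow> adj S (f u) (f v)"
    proof
      have fwd: "adj S (f u) (f (Suc u))" if "Suc u < a + c + 1" for u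
      proof (cases "u < a")
        case True
        thus ?thesis using adj_spiderI(2)[of 0 "a - Suc u"] by (simp add: f_def Suc_diff_Suc)
      next
        case False
        thus ?thesis using adj_spiderI(1)[of 1 "u - a"] that
          by (auto simp: f_def spider_vertex_def Suc_diff_le)
      qed
      show "adj S (f u) (f v)" if "v = Suc u \<or> u = Suc v"
        using that fwd[of u] fwd[of v] less adj_sym by blast
      assume "adj S (f u) (f v)"
      thus "v = Suc u \<or> u = Suc v"
      proof (rule adj_spiderE)
        have succ: "y = Suc x \<or> x = Suc y"
          if "i < b" "f x = spider_vertex i j" "f y = spider_vertex i (Suc j)" for x y i j
        proof -
          have "i = 0 \<or> i = 1" using that(1) by (simp only: lt2)
          thus ?thesis using that(2,3) by (auto simp: f_def spider_vertex_def split: if_splits)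
        qed
        show ?thesis if "i < b" "f u = spider_vertex i j" "f v = spider_vertex i (Suc j)" for i j
          using succ[OF that] .
        show ?thesis if "i < b" "f v = spider_vertex i j" "f u = spider_vertex i (Suc j)" for i j
          using succ[OF that] by blast
      qed
    qed
    finally show ?thesis .
  qed
  ultimately show ?thesis unfolding graph_iso_def by blast
qed

subsection \<open>Harmonic functions on spiders\<close>

context spider_lengths
begin

text \<open>Coordinates for harmonic functions: the value \<open>c\<close> at the centre and one
  slope per branch. At the centre \<open>j = 0\<close>, so the branch index stored there does not
  matter.\<close>

definition branch_linear :: "real \<Rightarrow> (nat \<Rightarrow> real) \<Rightarrow> nat \<times> nat \<Rightarrow> real" where
  "branch_linear c s = restrict (\<lambda>(i, j). c + real j * s i) (verts S)"

lemma branch_linear_spider_vertex: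
  "i < b \<Longrightarrow> j \<le> ls ! i \<Longrightarrow> branch_linear c s (spider_vertex i j) = c + real j * s i"
  using spider_vertex_mem[of i j] by (auto simp: branch_linear_def spider_vertex_def)

lemma branch_linear_center: "branch_linear c s (0, 0) = c"
  by (simp add: branch_linear_def verts_spider)

lemma branch_linear_branch:
  "i < b \<Longrightarrow> Suc j \<le> ls ! i \<Longrightarrow> branch_linear c s (i, Suc j) = c + real (Suc j) * s i"
  using branch_linear_spider_vertex[of i "Suc j"] by (simp add: spider_vertex_def)

lemma branch_linear_leaf: "i < b \<Longrightarrow> branch_linear c s (i, ls ! i) = c + real (ls ! i) * s i"
  using branch_linear_spider_vertex[of i "ls ! i"] nth_pos[of i] by (simp add: spider_vertex_def)

lemma sum_nbrs_center: "(\<Sum>w\<in>nbrs S (0, 0). f w) = (\<Sum>i<b. f (i, 1))"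
  unfolding nbrs_center by (subst sum.reindex) (auto simp: inj_on_def)

lemma sum_nbrs_branch:
  assumes "i < b" "Suc j \<le> ls ! i"
  shows "(\<Sum>w\<in>nbrs S (i, Suc j). f w) =
    f (spider_vertex i j) + (if Suc (Suc j) \<le> ls ! i then f (i, Suc (Suc j)) else 0)"
  unfolding nbrs_branch[OF assms] by (auto simp: spider_vertex_def)

lemma is_harmonic_spider_iff:
  "is_harmonic S g h \<longleftrightarrow> h \<in> extensional (verts S) \<and>
     (\<forall>i<b. h (i, ls ! i) = g (i, ls ! i)) \<and>
     (\<Sum>i<b. h (0, 0) - h (i, 1)) = 0 \<and>
     (\<forall>i<b. \<forall>j. Suc j < ls ! i \<longrightarrow>
        h (i, Suc j) - h (spider_vertex i j) + (h (i, Suc j) - h (i, Suc (Suc j))) = 0)"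
proof -
  have "(\<forall>v\<in>leaves S. h v = g v) \<longleftrightarrow> (\<forall>i<b. h (i, ls ! i) = g (i, ls ! i))"
    unfolding leaves_spider by auto
  moreover have "(\<Sum>w\<in>nbrs S (i, Suc j). h (i, Suc j) - h w) =
      h (i, Suc j) - h (spider_vertex i j) + (h (i, Suc j) - h (i, Suc (Suc j)))"
    if "i < b" "Suc j < ls ! i" for i j
    using that by (subst sum_nbrs_branch) auto
  hence "(\<forall>v\<in>verts S - leaves S. (\<Sum>w\<in>nbrs S v. h v - h w) = 0) \<longleftrightarrow>
      (\<Sum>i<b. h (0, 0) - h (i, 1)) = 0 \<and>
      (\<forall>i<b. \<forall>j. Suc j < ls ! i \<longrightarrow>
        h (i, Suc j) - h (spider_vertex i j) + (h (i, Suc j) - h (i, Suc (Suc j))) = 0)"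
    unfolding interior_spider by (auto simp: sum_nbrs_center[of "\<lambda>w. h (0, 0) - h w"])
  ultimately show ?thesis unfolding is_harmonic_def by blast
qed

text \<open>At a vertex with two neighbours the equation says that the second difference vanishes,
  so \<open>h\<close> is affine on each branch. At the centre it becomes Kirchhoff's law: the
  outgoing slopes add up to 0.\<close>

lemma is_harmonic_iff_branch_linear:
  "is_harmonic S g h \<longleftrightarrow> (\<exists>c s. h = branch_linear c s \<and> (\<Sum>i<b. s i) = 0 \<and>
     (\<forall>i<b. g (i, ls ! i) = c + real (ls ! i) * s i))"
proof
  assume "\<exists>c s. h = branch_linear c s \<and> (\<Sum>i<b. s i) = 0 \<and>
     (\<forall>i<b. g (i, ls ! i) = c + real (ls ! i) * s i)"
  then obtain c s where h: "h = branch_linear c s" and s: "(\<Sum>i<b. s i) = 0"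
    and g: "\<And>i. i < b \<Longrightarrow> g (i, ls ! i) = c + real (ls ! i) * s i" by blast
  have "h (i, 1) = c + s i" if "i < b" for i
    using branch_linear_branch[of i 0] that nth_pos[OF that] by (simp add: h)
  hence "(\<Sum>i<b. h (0, 0) - h (i, 1)) = (\<Sum>i<b. - s i)"
    by (intro sum.cong) (auto simp: h branch_linear_center)
  hence "(\<Sum>i<b. h (0, 0) - h (i, 1)) = 0" using s by (simp add: sum_negf)
  moreover have "h \<in> extensional (verts S)" by (simp add: h branch_linear_def)
  ultimately show "is_harmonic S g h"
    unfolding is_harmonic_spider_iff
    by (auto simp: h g branch_linear_leaf branch_linear_branch branch_linear_spider_vertex
        algebra_simps)
next
  assume h: "is_harmonic S g h"
  define c where "c = h (0, 0)"
  define s where "s i = h (i, 1) - c" for i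
  have interior: "h (i, Suc (Suc j)) = 2 * h (i, Suc j) - h (spider_vertex i j)"
    if "i < b" "Suc j < ls ! i" for i j
    using h that unfolding is_harmonic_spider_iff by force
  have sv0: "spider_vertex i 0 = (0, 0)" for i by (simp add: spider_vertex_def)
  have svS: "spider_vertex i (Suc j) = (i, Suc j)" for i j by (simp add: spider_vertex_def)
  have lin: "h (spider_vertex i j) = c + real j * s i" if "i < b" "j \<le> ls ! i" for i j
    using that(2)
  proof (induction j rule: less_induct)
    case (less j)
    consider "j = 0" | "j = 1" | k where "j = Suc (Suc k)" by (metis One_nat_def not0_implies_Suc)
    thus ?case
    proof cases
      case (3 k)
      have "h (spider_vertex i k) = c + real k * s i" using less 3 by simp
      moreover have "h (spider_vertex i (Suc k)) = c + real (Suc k) * s i" using less 3 by simp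
      ultimately show ?thesis
        using interior[of i k] that(1) less.prems 3 by (simp add: svS algebra_simps)
    qed (auto simp: sv0 svS c_def s_def)
  qed
  have ext: "h \<in> extensional (verts S)" using h by (simp add: is_harmonic_def)
  have "h = branch_linear c s"
  proof (rule extensionalityI[OF ext])
    show "branch_linear c s \<in> extensional (verts S)" by (simp add: branch_linear_def)
    fix v assume "v \<in> verts S"
    then obtain i j where "v = spider_vertex i j" "i < b" "j \<le> ls ! i"
      unfolding spider_def by auto
    thus "h v = branch_linear c s v" by (simp add: lin branch_linear_spider_vertex)
  qed
  moreover have "(\<Sum>i<b. c - h (i, 1)) = 0"
    using h unfolding is_harmonic_spider_iff c_def by blast
  hence "(\<Sum>i<b. - s i) = 0" by (simp add: s_def)
  hence "(\<Sum>i<b. s i) = 0" by (simp add: sum_negf)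
  moreover have "g (i, ls ! i) = c + real (ls ! i) * s i" if "i < b" for i
  proof -
    have "spider_vertex i (ls ! i) = (i, ls ! i)" using nth_pos[OF that] by (simp add: spider_vertex_def)
    thus ?thesis using lin[OF that, of "ls ! i"] h that unfolding is_harmonic_spider_iff by simp
  qed
  ultimately show "\<exists>c s. h = branch_linear c s \<and> (\<Sum>i<b. s i) = 0 \<and>
     (\<forall>i<b. g (i, ls ! i) = c + real (ls ! i) * s i)" by blast
qed

text \<open>The leaf values and \<open>c\<close> determine the slopes, and Kirchhoff's law is then
  one linear equation for \<open>c\<close> with coefficient \<open>W > 0\<close>. Its solution
  \<open>c0\<close> is the mean of the leaf values with weights \<open>1 / l\<close>.\<close>

lemma uniquely_harmonic_spider: "uniquely_harmonic S"
  unfolding uniquely_harmonic_def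
proof
  fix g :: "nat \<times> nat \<Rightarrow> real"
  let ?g = "\<lambda>i. g (i, ls ! i)" and ?l = "\<lambda>i. real (ls ! i)"
  define W where "W = (\<Sum>i<b. 1 / ?l i)"
  have lpos: "?l i > 0" if "i < b" for i using nth_pos[OF that] by simp
  have "W > 0" unfolding W_def using two_branches lpos by (intro sum_pos) (auto simp: lessThan_empty_iff)
  have sum_eq: "(\<Sum>i<b. (?g i - c) / ?l i) = (\<Sum>i<b. ?g i / ?l i) - c * W" for c
    by (simp add: W_def diff_divide_distrib sum_subtractf sum_distrib_left)
  define c0 where "c0 = (\<Sum>i<b. ?g i / ?l i) / W"
  let ?h = "branch_linear c0 (\<lambda>i. (?g i - c0) / ?l i)"
  have "(\<Sum>i<b. (?g i - c0) / ?l i) = 0"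
    unfolding sum_eq using \<open>W > 0\<close> by (simp add: c0_def)
  moreover have "\<forall>i<b. ?g i = c0 + ?l i * ((?g i - c0) / ?l i)"
    using lpos by auto
  ultimately have "is_harmonic S g ?h"
    unfolding is_harmonic_iff_branch_linear
    by (intro exI[of _ c0] exI[of _ "\<lambda>i. (?g i - c0) / ?l i"]) simp
  moreover have "h = ?h" if harm: "is_harmonic S g h" for h
  proof -
    obtain c s where h: "h = branch_linear c s" and s: "(\<Sum>i<b. s i) = 0"
      and g: "\<And>i. i < b \<Longrightarrow> ?g i = c + ?l i * s i"
      using harm unfolding is_harmonic_iff_branch_linear by blast
    have s_eq: "s i = (?g i - c) / ?l i" if "i < b" for i
      using lpos[OF that] g[OF that] by (simp add: field_simps)
    hence "(\<Sum>i<b. (?g i - c) / ?l i) = 0" using s by simp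
    hence "c = c0" unfolding sum_eq using \<open>W > 0\<close> by (simp add: c0_def field_simps)
    show ?thesis unfolding h branch_linear_def
      by (rule restrict_ext) (auto simp: verts_spider s_eq \<open>c = c0\<close>)
  qed
  ultimately show "\<exists>!h. is_harmonic S g h" by blast
qed

lemma energy_branch_linear: "energy S (branch_linear c s) = (\<Sum>i<b. real (ls ! i) * (s i)\<^sup>2)"
proof -
  let ?h = "branch_linear c s"
  have center: "(\<Sum>w\<in>nbrs S (0, 0). (?h (0, 0) - ?h w)\<^sup>2) = (\<Sum>i<b. (s i)\<^sup>2)"
  proof -
    have "?h (i, 1) = c + s i" if "i < b" for i
      using branch_linear_branch[of i 0] that nth_pos[OF that] by simp
    thus ?thesis unfolding sum_nbrs_center[of "\<lambda>w. (?h (0, 0) - ?h w)\<^sup>2"]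
      by (intro sum.cong) (auto simp: branch_linear_center)
  qed
  \<comment> \<open>A branch of length \<open>l\<close> carries \<open>2 * l\<close> ordered
    adjacent pairs. The one starting at the centre is already counted in \<open>center\<close>,
    hence the factor \<open>2 * l - 1\<close>.\<close>
  have branch: "(\<Sum>j=1..ls ! i. \<Sum>w\<in>nbrs S (i, j). (?h (i, j) - ?h w)\<^sup>2)
      = (2 * real (ls ! i) - 1) * (s i)\<^sup>2" if i: "i < b" for i
  proof -
    obtain m where m: "ls ! i = Suc m" using nth_pos[OF i] by (auto simp: gr0_conv_Suc)
    have "(\<Sum>w\<in>nbrs S (i, Suc j). (?h (i, Suc j) - ?h w)\<^sup>2) =
        (if j < m then 2 * (s i)\<^sup>2 else (s i)\<^sup>2)" if "j < Suc m" for j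
      using that i m
      by (subst sum_nbrs_branch)
        (auto simp: branch_linear_branch branch_linear_spider_vertex algebra_simps power2_eq_square)
    hence "(\<Sum>j<Suc m. \<Sum>w\<in>nbrs S (i, Suc j). (?h (i, Suc j) - ?h w)\<^sup>2)
      = (\<Sum>j<Suc m. if j < m then 2 * (s i)\<^sup>2 else (s i)\<^sup>2)"
      by (intro sum.cong) auto
    hence "(\<Sum>j=1..ls ! i. \<Sum>w\<in>nbrs S (i, j). (?h (i, j) - ?h w)\<^sup>2)
      = (\<Sum>j<Suc m. if j < m then 2 * (s i)\<^sup>2 else (s i)\<^sup>2)"
      unfolding m by (simp only: sum.atLeast1_atMost_eq One_nat_def)
    thus ?thesis by (simp add: m algebra_simps)
  qed
  have "2 * energy S ?h = (\<Sum>i<b. (s i)\<^sup>2) + (\<Sum>i<b. (2 * real (ls ! i) - 1) * (s i)\<^sup>2)"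
    unfolding energy_def sum_verts_spider center by (simp add: branch del: One_nat_def)
  also have "\<dots> = (\<Sum>i<b. 2 * (real (ls ! i) * (s i)\<^sup>2))"
    unfolding sum.distrib[symmetric] by (intro sum.cong) (auto simp: algebra_simps)
  finally show ?thesis by (simp add: sum_distrib_left[symmetric])
qed

text \<open>From here on the graph is gone: the eigenvalue is a constrained minimum over the pairs
  \<open>(c, s)\<close>.\<close>

lemma rayleigh_quotients_spider_iff:
  "x \<in> rayleigh_quotients S \<longleftrightarrow> (\<exists>c s. (\<Sum>i<b. s i) = 0 \<and>
     (\<Sum>i<b. c + real (ls ! i) * s i) = 0 \<and> (\<exists>i<b. c + real (ls ! i) * s i \<noteq> 0) \<and>
     x = (\<Sum>i<b. real (ls ! i) * (s i)\<^sup>2) / (\<Sum>i<b. (c + real (ls ! i) * s i)\<^sup>2))"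
proof
  assume "x \<in> rayleigh_quotients S"
  then obtain g where x: "x = energy S (harmonic_extension S g) / (\<Sum>w\<in>leaves S. (g w)\<^sup>2)"
    and g: "\<exists>w\<in>leaves S. g w \<noteq> 0" "(\<Sum>w\<in>leaves S. g w) = 0"
    unfolding rayleigh_quotients_def by blast
  obtain h where h: "is_harmonic S g h"
    using uniquely_harmonic_spider unfolding uniquely_harmonic_def by blast
  then obtain c s where cs: "h = branch_linear c s" "(\<Sum>i<b. s i) = 0"
    "\<And>i. i < b \<Longrightarrow> g (i, ls ! i) = c + real (ls ! i) * s i"
    unfolding is_harmonic_iff_branch_linear by blast
  have "harmonic_extension S g = branch_linear c s"
    using harmonic_extension_eq[OF uniquely_harmonic_spider h] cs(1) by simp
  hence "x = (\<Sum>i<b. real (ls ! i) * (s i)\<^sup>2) / (\<Sum>i<b. (c + real (ls ! i) * s i)\<^sup>2)"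
    by (simp add: x energy_branch_linear sum_leaves_spider cs(3))
  moreover have "(\<Sum>i<b. c + real (ls ! i) * s i) = 0"
    using g(2) by (simp add: sum_leaves_spider cs(3))
  moreover have "\<exists>i<b. c + real (ls ! i) * s i \<noteq> 0"
    using g(1) cs(3) unfolding leaves_spider by auto
  ultimately show "\<exists>c s. (\<Sum>i<b. s i) = 0 \<and>
     (\<Sum>i<b. c + real (ls ! i) * s i) = 0 \<and> (\<exists>i<b. c + real (ls ! i) * s i \<noteq> 0) \<and>
     x = (\<Sum>i<b. real (ls ! i) * (s i)\<^sup>2) / (\<Sum>i<b. (c + real (ls ! i) * s i)\<^sup>2)"
    using cs(2) by blast
next
  assume "\<exists>c s. (\<Sum>i<b. s i) = 0 \<and>
     (\<Sum>i<b. c + real (ls ! i) * s i) = 0 \<and> (\<exists>i<b. c + real (ls ! i) * s i \<noteq> 0) \<and>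
     x = (\<Sum>i<b. real (ls ! i) * (s i)\<^sup>2) / (\<Sum>i<b. (c + real (ls ! i) * s i)\<^sup>2)"
  then obtain c s where s: "(\<Sum>i<b. s i) = 0" "(\<Sum>i<b. c + real (ls ! i) * s i) = 0"
    "\<exists>i<b. c + real (ls ! i) * s i \<noteq> 0"
    and x: "x = (\<Sum>i<b. real (ls ! i) * (s i)\<^sup>2) / (\<Sum>i<b. (c + real (ls ! i) * s i)\<^sup>2)"
    by blast
  define g where "g = (\<lambda>(i, j). c + real j * s i)"
  have "is_harmonic S g (branch_linear c s)"
    unfolding is_harmonic_iff_branch_linear using s(1) by (auto simp: g_def)
  hence "harmonic_extension S g = branch_linear c s"
    using harmonic_extension_eq[OF uniquely_harmonic_spider] by blast
  hence "x = energy S (harmonic_extension S g) / (\<Sum>w\<in>leaves S. (g w)\<^sup>2)"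
    by (simp add: x energy_branch_linear sum_leaves_spider g_def)
  moreover have "\<exists>w\<in>leaves S. g w \<noteq> 0" "(\<Sum>w\<in>leaves S. g w) = 0"
    using s(2,3) unfolding sum_leaves_spider by (auto simp: leaves_spider g_def)
  ultimately show "x \<in> rayleigh_quotients S" unfolding rayleigh_quotients_def by blast
qed

end

subsection \<open>The secular equation\<close>

text \<open>The Steklov condition at a leaf is: slope equals \<open>x\<close> times leaf value. With
  value 1 at the centre it forces the leaf value \<open>1 / (1 - l * x)\<close>. A zero of the sum
  thus gives mean zero on the boundary and Kirchhoff's law at once. At a pole the term is
  \<open>1 / 0 = 0\<close>, so all later arguments stay between poles.\<close>

definition secular :: "nat list \<Rightarrow> real \<Rightarrow> real" where
  "secular ls x = (\<Sum>l\<leftarrow>ls. 1 / (1 - real l * x))"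

text \<open>For a given total \<open>- u0\<close>, the positive squares are at least
  \<open>u0\<close> squared divided by the sum of the reciprocals \<open>1 / A i\<close>. The bound
  on the reciprocals makes this outweigh the negative square.\<close>

lemma one_negative_square_nonneg:
  fixes A u :: "'i \<Rightarrow> real"
  assumes "finite I" "\<And>i. i \<in> I \<Longrightarrow> A i > 0" "A0 < 0"
    and "u0 + (\<Sum>i\<in>I. u i) = 0" and "1 / A0 + (\<Sum>i\<in>I. 1 / A i) \<le> 0"
  shows "0 \<le> A0 * u0\<^sup>2 + (\<Sum>i\<in>I. A i * (u i)\<^sup>2)"
proof -
  \<comment> \<open>The Lagrange multiplier of the extremal case, where the reciprocals add up to 0
    and every \<open>A i * u i\<close> equals \<open>A0 * u0\<close>.\<close>
  define t where "t = A0 * u0"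
  have "2 * t * u i - t\<^sup>2 * (1 / A i) \<le> A i * (u i)\<^sup>2" if "i \<in> I" for i
  proof -
    have "0 \<le> A i * (u i - t / A i)\<^sup>2" using assms(2)[OF that] by simp
    also have "\<dots> = A i * (u i)\<^sup>2 - 2 * t * u i + t\<^sup>2 * (1 / A i)"
      using assms(2)[OF that] by (simp add: power2_eq_square field_simps)
    finally show ?thesis by simp
  qed
  hence "(\<Sum>i\<in>I. 2 * t * u i - t\<^sup>2 * (1 / A i)) \<le> (\<Sum>i\<in>I. A i * (u i)\<^sup>2)" by (rule sum_mono)
  moreover have "(\<Sum>i\<in>I. 2 * t * u i - t\<^sup>2 * (1 / A i))
      = 2 * t * (\<Sum>i\<in>I. u i) - t\<^sup>2 * (\<Sum>i\<in>I. 1 / A i)"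
    by (simp only: sum_subtractf sum_distrib_left)
  moreover have "t\<^sup>2 * (\<Sum>i\<in>I. 1 / A i) \<le> t\<^sup>2 * (- (1 / A0))"
    using assms(5) by (intro mult_left_mono) auto
  moreover have "t\<^sup>2 * (- (1 / A0)) = - (A0 * u0\<^sup>2)"
    using assms(3) by (simp add: t_def power2_eq_square)
  moreover have "(\<Sum>i\<in>I. u i) = - u0" using assms(4) by simp
  moreover have "2 * t * (- u0) = - 2 * (A0 * u0\<^sup>2)" by (simp add: t_def power2_eq_square)
  ultimately show ?thesis by simp
qed

text \<open>At a root \<open>x\<close> of the secular function, \<open>g i = 1 / (1 - l i * x)\<close> are the leaf values of
  an eigenfunction whose value at the centre is \<open>1\<close>. Completing the square around multiples of it
  turns (energy) \<open>- x\<close> (boundary norm) into a diagonal form with one negative coefficient.\<close>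

lemma steklov_lambda2_spider:
  assumes "spider_lengths (a # as)" and x: "x > 0" and root: "secular (a # as) x = 0"
    and neg: "1 - real a * x < 0" and pos: "\<And>l. l \<in> set as \<Longrightarrow> 1 - real l * x > 0"
  shows "steklov_lambda2 (spider (a # as)) = x"
proof -
  interpret spider_lengths "a # as" by fact
  let ?l = "\<lambda>i. real ((a # as) ! i)"
  define p where "p i = 1 / (1 - ?l i * x)" for i
  have sum_split: "(\<Sum>i<b. f i) = f 0 + (\<Sum>i<length as. f (Suc i))" for f :: "nat \<Rightarrow> real"
    by (simp add: sum.lessThan_Suc_shift del: sum.lessThan_Suc)
  have den_pos: "1 - ?l (Suc i) * x > 0" if "i < length as" for i
    using that pos[of "as ! i"] by simp
  have den: "1 - ?l i * x \<noteq> 0" if "i < b" for i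
    using that den_pos[of "i - 1"] neg by (cases i) auto
  have lpos: "?l i > 0" if "i < b" for i using nth_pos[OF that] by simp
  have "secular (a # as) x = (\<Sum>i<b. p i)"
    unfolding secular_def sum_list_sum_nth length_map p_def atLeast0LessThan
    by (intro sum.cong refl) (simp del: list.map)
  hence psum: "(\<Sum>i<b. p i) = 0" using root by simp
  \<comment> \<open>The Steklov condition at the leaf: from value 1 at the centre, slope
    \<open>x * p i\<close> leads to the leaf value \<open>p i\<close>.\<close>
  have lp: "?l i * x * p i = p i - 1" if "i < b" for i
    using den[OF that] by (simp add: p_def field_simps)
  show ?thesis
  proof (rule steklov_lambda2_eqI)
    have leaf: "1 + ?l i * (x * p i) = p i" if "i < b" for i
      using lp[OF that] by (simp add: mult.assoc)
    have p0: "p 0 \<noteq> 0" using neg by (simp add: p_def)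
    have sq: "(\<Sum>i<b. (p i)\<^sup>2) > 0"
      using p0 by (intro sum_pos2[of _ 0]) auto
    have "(\<Sum>i<b. ?l i * (x * p i)\<^sup>2) = (\<Sum>i<b. x * (p i)\<^sup>2 - x * p i)"
    proof (rule sum.cong)
      fix i assume "i \<in> {..<b}"
      have "?l i * (x * p i)\<^sup>2 = x * p i * (?l i * x * p i)"
        by (simp add: power2_eq_square)
      also have "\<dots> = x * p i * (p i - 1)" using lp[of i] \<open>i \<in> {..<b}\<close> by simp
      finally show "?l i * (x * p i)\<^sup>2 = x * (p i)\<^sup>2 - x * p i"
        by (simp add: power2_eq_square algebra_simps)
    qed simp
    also have "\<dots> = x * (\<Sum>i<b. (p i)\<^sup>2)"
      using psum by (simp only: sum_subtractf sum_distrib_left[symmetric] mult_zero_right diff_zero)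
    finally have "x = (\<Sum>i<b. ?l i * (x * p i)\<^sup>2) / (\<Sum>i<b. (p i)\<^sup>2)"
      using sq by simp
    hence "x = (\<Sum>i<b. ?l i * (x * p i)\<^sup>2) / (\<Sum>i<b. (1 + ?l i * (x * p i))\<^sup>2)"
      using leaf by simp
    moreover have "(\<Sum>i<b. x * p i) = 0" using psum by (simp only: sum_distrib_left[symmetric] mult_zero_right)
    moreover have "(\<Sum>i<b. 1 + ?l i * (x * p i)) = 0"
      using psum leaf by simp
    moreover have "\<exists>i<b. 1 + ?l i * (x * p i) \<noteq> 0" using p0 leaf[of 0] by (intro exI[of _ 0]) auto
    ultimately show "x \<in> rayleigh_quotients S"
      unfolding rayleigh_quotients_spider_iff
      by (intro exI[of _ "1 :: real"] exI[of _ "\<lambda>i. x * p i"] conjI)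
  next
    fix y assume "y \<in> rayleigh_quotients S"
    then obtain c s where ssum: "(\<Sum>i<b. s i) = 0" and gsum: "(\<Sum>i<b. c + ?l i * s i) = 0"
      and nz: "\<exists>i<b. c + ?l i * s i \<noteq> 0"
      and y: "y = (\<Sum>i<b. ?l i * (s i)\<^sup>2) / (\<Sum>i<b. (c + ?l i * s i)\<^sup>2)"
      unfolding rayleigh_quotients_spider_iff by blast
    define g where "g i = c + ?l i * s i" for i
    \<comment> \<open>Subtracting \<open>c\<close> times the eigenfunction gives a function
      vanishing at the centre, with leaf value \<open>u i\<close> and slope \<open>u i / l\<close>.
      Energy minus \<open>x\<close> times norm is then \<open>A i\<close> times the square of
      \<open>u i\<close> on branch \<open>i\<close>.\<close>
    define A where "A i = (1 - ?l i * x) / ?l i" for i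
    define u where "u i = g i - c * p i" for i
    have g0: "(\<Sum>i<b. g i) = 0" using gsum by (simp only: g_def)
    have gpos: "(\<Sum>i<b. (g i)\<^sup>2) > 0"
    proof -
      obtain i where "i < b" "g i \<noteq> 0" using nz unfolding g_def by blast
      thus ?thesis by (intro sum_pos2[of _ i]) auto
    qed
    have "(\<Sum>i<b. u i) = (\<Sum>i<b. g i) - c * (\<Sum>i<b. p i)"
      by (simp only: u_def sum_subtractf sum_distrib_left)
    hence usum: "u 0 + (\<Sum>i<length as. u (Suc i)) = 0"
      unfolding g0 psum by (simp only: sum_split)
    \<comment> \<open>\<open>1 / A i\<close> is \<open>l / (1 - l * x)\<close>, so at a root the
      reciprocals add up to \<open>- b / x\<close>.\<close>
    have Ainv: "1 / A i = (p i - 1) / x" if "i < b" for i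
      using lp[OF that] x lpos[OF that] den[OF that] by (simp add: A_def p_def field_simps)
    have "(\<Sum>i<b. 1 / A i) = (\<Sum>i<b. (p i - 1) / x)" by (intro sum.cong) (auto simp: Ainv)
    also have "\<dots> = - real b / x"
      using psum by (simp only: sum_divide_distrib[symmetric] sum_subtractf) simp
    also have "\<dots> \<le> 0" using x by (intro divide_nonpos_pos) auto
    finally have Asum: "1 / A 0 + (\<Sum>i<length as. 1 / A (Suc i)) \<le> 0"
      by (simp only: sum_split)
    have "0 \<le> A 0 * (u 0)\<^sup>2 + (\<Sum>i<length as. A (Suc i) * (u (Suc i))\<^sup>2)"
    proof (rule one_negative_square_nonneg[OF _ _ _ usum Asum])
      show "A (Suc i) > 0" if "i \<in> {..<length as}" for i
        using that den_pos[of i] lpos[of "Suc i"] by (simp add: A_def)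
      show "A 0 < 0" using neg lpos[of 0] by (simp add: A_def divide_neg_pos)
    qed simp
    hence "0 \<le> (\<Sum>i<b. A i * (u i)\<^sup>2)" by (simp only: sum_split)
    \<comment> \<open>The summand with \<open>p i\<close> makes the identity hold branch by branch;
      at a root it disappears in the total.\<close>
    also have "\<dots> = (\<Sum>i<b. ?l i * (s i)\<^sup>2 - x * (g i)\<^sup>2 + x * c\<^sup>2 * p i)"
    proof (rule sum.cong)
      fix i assume "i \<in> {..<b}"
      hence i: "i < b" by simp
      have p1: "(1 - ?l i * x) * p i = 1" using den[OF i] by (simp add: p_def)
      have "?l i * (A i * (u i)\<^sup>2) = (1 - ?l i * x) * (u i)\<^sup>2"
        using lpos[OF i] by (simp add: A_def)
      also have "\<dots> = (1 - ?l i * x) * (g i)\<^sup>2 - 2 * c * g i * ((1 - ?l i * x) * p i)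
          + c\<^sup>2 * p i * ((1 - ?l i * x) * p i)"
        by (simp add: u_def power2_eq_square algebra_simps)
      also have "\<dots> = (g i - c)\<^sup>2 - ?l i * x * (g i)\<^sup>2 + c\<^sup>2 * (p i - 1)"
        unfolding p1 by (simp add: power2_eq_square algebra_simps)
      also have "\<dots> = ?l i * (?l i * (s i)\<^sup>2 - x * (g i)\<^sup>2 + x * c\<^sup>2 * p i)"
        unfolding lp[OF i, symmetric] by (simp add: g_def power2_eq_square algebra_simps)
      finally show "A i * (u i)\<^sup>2 = ?l i * (s i)\<^sup>2 - x * (g i)\<^sup>2 + x * c\<^sup>2 * p i"
        using lpos[OF i] by simp
    qed simp
    also have "\<dots> = (\<Sum>i<b. ?l i * (s i)\<^sup>2) - x * (\<Sum>i<b. (g i)\<^sup>2) + x * c\<^sup>2 * (\<Sum>i<b. p i)"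
      by (simp only: sum.distrib sum_subtractf sum_distrib_left)
    finally have "x * (\<Sum>i<b. (g i)\<^sup>2) \<le> (\<Sum>i<b. ?l i * (s i)\<^sup>2)" by (simp only: psum)
    thus "x \<le> y" using gpos unfolding y g_def by (simp only: pos_le_divide_eq)
  qed
qed

lemma inverse_affine_strict_mono:
  fixes l x y :: real
  assumes "0 < l" "x < y" "1 - l * x > 0 \<and> 1 - l * y > 0 \<or> 1 - l * x < 0 \<and> 1 - l * y < 0"
  shows "1 / (1 - l * x) < 1 / (1 - l * y)"
proof -
  have "l * x < l * y" using assms by simp
  thus ?thesis using assms(3) by (auto simp: divide_simps)
qed

lemma secular_strict_mono:
  assumes "\<And>l. l \<in> set (a # as) \<Longrightarrow> 0 < l" and "x < y"
    and "1 - real a * x < 0" "1 - real a * y < 0"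
    and "\<And>l. l \<in> set as \<Longrightarrow> 1 - real l * x > 0" "\<And>l. l \<in> set as \<Longrightarrow> 1 - real l * y > 0"
  shows "secular (a # as) x < secular (a # as) y"
  unfolding secular_def
proof (rule sum_list_strict_mono)
  fix l assume "l \<in> set (a # as)"
  thus "1 / (1 - real l * x) < 1 / (1 - real l * y)"
    using assms by (intro inverse_affine_strict_mono) auto
qed simp

text \<open>Signs at two explicit points inside the interval replace the limits at its two poles in
  the intermediate value argument.\<close>

lemma secular_root_exists:
  assumes "a2 < a1" "0 < a2" "\<And>m. m \<in> set ms \<Longrightarrow> m \<le> a2"
  shows "\<exists>x. 1 / real a1 < x \<and> x < 1 / real a2 \<and> secular (a1 # a2 # ms) x = 0"
proof -
  define N where "N = real (length (a2 # ms))"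
  let ?a = "real a1" and ?c = "real a2"
  \<comment> \<open>\<open>x0\<close> solves the equation in which all branches but the first have
    length \<open>a2\<close>, which can only enlarge the secular function; \<open>x1\<close> solves
    the one in which only the two longest branches are kept, which drops nonnegative terms.\<close>
  define x0 where "x0 = (N + 1) / (N * ?a + ?c)"
  define x1 where "x1 = 2 / (?a + ?c)"
  have N: "N \<ge> 1" by (simp add: N_def)
  have ac: "?c < ?a" "0 < ?c" using assms by auto
  have Dn: "N * ?a + ?c > 0" using N ac by (intro add_pos_pos mult_pos_pos) auto
  have e1: "?a * x0 - 1 = (?a - ?c) / (N * ?a + ?c)"
    using Dn by (simp add: x0_def field_simps)
  have e2: "1 - ?c * x0 = N * (?a - ?c) / (N * ?a + ?c)"
    using Dn by (simp add: x0_def field_simps)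
  have e3: "?a * x1 - 1 = (?a - ?c) / (?a + ?c)" "1 - ?c * x1 = (?a - ?c) / (?a + ?c)"
    using ac by (auto simp: x1_def field_simps)
  have p0: "?a * x0 - 1 > 0" unfolding e1 using ac Dn by simp
  have p1: "1 - ?c * x1 > 0" unfolding e3 using ac by simp
  have x01: "x0 \<le> x1"
  proof -
    have "0 \<le> (N - 1) * (?a - ?c)" using N ac by simp
    hence "(N + 1) * (?a + ?c) \<le> 2 * (N * ?a + ?c)" by (simp add: algebra_simps)
    thus ?thesis unfolding x0_def x1_def using Dn ac by (simp add: divide_simps)
  qed
  have neg: "1 - ?a * x < 0" if "x0 \<le> x" for x
    using p0 mult_left_mono[OF that, of ?a] by simp
  have x0pos: "0 < x0" unfolding x0_def using N Dn by simp
  have le: "1 - ?c * x \<le> 1 - real l * x" if "l \<in> set (a2 # ms)" "x0 \<le> x" for l x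
    using assms(3) that x0pos by (auto intro!: mult_right_mono)
  have posc: "1 - ?c * x > 0" if "x \<le> x1" for x
    using p1 mult_left_mono[OF that, of ?c] by simp
  have pos: "1 - real l * x > 0" if "l \<in> set (a2 # ms)" "x0 \<le> x" "x \<le> x1" for l x
    using le[OF that(1,2)] posc[OF that(3)] by linarith
  have "secular (a1 # a2 # ms) x0 \<le> 0"
  proof -
    have "(\<Sum>l\<leftarrow>a2 # ms. 1 / (1 - real l * x0)) \<le> (\<Sum>l\<leftarrow>a2 # ms. 1 / (1 - ?c * x0))"
      by (intro sum_list_mono divide_left_mono mult_pos_pos le pos posc x01 order.refl) auto
    also have "\<dots> = N / (1 - ?c * x0)" by (simp add: N_def sum_list_triv add_divide_distrib)
    also have "\<dots> = 1 / (?a * x0 - 1)" unfolding e1 e2 using N ac Dn by simp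
    also have "\<dots> = - (1 / (1 - ?a * x0))" using p0 by (simp add: divide_simps)
    finally show ?thesis by (simp add: secular_def)
  qed
  moreover have "0 \<le> secular (a1 # a2 # ms) x1"
  proof -
    have "0 \<le> (\<Sum>l\<leftarrow>ms. 1 / (1 - real l * x1))"
      using pos[OF _ x01] by (intro sum_list_nonneg) (auto intro: less_imp_le)
    moreover have "1 - ?a * x1 = - (1 - ?c * x1)" using e3 by simp
    hence "1 / (1 - ?a * x1) + 1 / (1 - ?c * x1) = 0" by (simp only: divide_minus_right left_minus)
    ultimately show ?thesis by (simp add: secular_def)
  qed
  moreover have "continuous_on {x0..x1} (secular (a1 # a2 # ms))"
  proof -
    have "continuous_on {x0..x1} (secular ls)" if "set ls \<subseteq> set (a1 # a2 # ms)" for ls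
      using that
    proof (induction ls)
      case (Cons l ls)
      have "continuous_on {x0..x1} (\<lambda>x. 1 / (1 - real l * x) + secular ls x)"
        using Cons neg pos by (intro continuous_intros) fastforce+
      thus ?case by (simp add: secular_def[abs_def])
    qed (simp add: secular_def[abs_def])
    thus ?thesis by simp
  qed
  ultimately obtain x where x: "x0 \<le> x" "x \<le> x1" "secular (a1 # a2 # ms) x = 0"
    using IVT'[of "secular (a1 # a2 # ms)" x0 0 x1] x01 by blast
  have "1 / ?a < x" "x < 1 / ?c"
    using neg[OF x(1)] posc[OF x(2)] ac by (auto simp: divide_simps mult.commute)
  thus ?thesis using x(3) by blast
qed

subsection \<open>Balancing the branch lengths\<close>

definition balanced_lengths :: "nat \<Rightarrow> nat \<Rightarrow> nat \<Rightarrow> nat list" where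
  "balanced_lengths q c t = replicate t (c + 1) @ replicate (q - t) c"

text \<open>When all entries are \<open>c\<close> or \<open>c + 1\<close>, the excess of the sum
  over \<open>length ms * c\<close> counts the entries \<open>c + 1\<close>.\<close>

lemma balanced_lengths_mset_eq:
  assumes "set ms \<subseteq> {c, c + 1}" "sum_list ms = length ms * c + t" "t < length ms"
  shows "mset ms = mset (balanced_lengths (length ms) c t)"
proof -
  have "\<exists>k\<le>length ms. sum_list ms = length ms * c + k \<and>
      mset ms = replicate_mset k (c + 1) + replicate_mset (length ms - k) c"
    using assms(1)
  proof (induction ms)
    case (Cons m ms)
    then obtain k where k: "k \<le> length ms" "sum_list ms = length ms * c + k"
      "mset ms = replicate_mset k (c + 1) + replicate_mset (length ms - k) c" by auto
    show ?case
    proof (cases "m = c")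
      case True
      thus ?thesis using k by (intro exI[of _ k]) (auto simp: Suc_diff_le)
    next
      case False
      thus ?thesis using k Cons.prems by (intro exI[of _ "Suc k"]) auto
    qed
  qed simp
  thus ?thesis using assms(2) by (auto simp: balanced_lengths_def)
qed

lemma sum_balanced_lengths:
  "(\<Sum>m\<leftarrow>balanced_lengths q c t. f m) = real t * f (c + 1) + real (q - t) * f c"
  by (simp add: balanced_lengths_def map_replicate_const sum_list_replicate)

text \<open>The exact error of linear interpolation at the nodes \<open>c\<close> and
  \<open>c + 1\<close>, with the second divided difference as a factor. Exactness yields the
  equality case along with the inequality.\<close>

lemma reciprocal_chord_eq:
  fixes x :: real
  assumes "1 - m * x \<noteq> 0" "1 - c * x \<noteq> 0" "1 - (c + 1) * x \<noteq> 0"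
  shows "1 / (1 - m * x) - (1 / (1 - c * x) + (m - c) * (1 / (1 - (c + 1) * x) - 1 / (1 - c * x)))
    = (m - c) * (m - c - 1) * x\<^sup>2 / ((1 - m * x) * (1 - c * x) * (1 - (c + 1) * x))"
proof -
  define u where "u = 1 - m * x"
  define v where "v = 1 - c * x"
  define w where "w = 1 - (c + 1) * x"
  have nz: "u \<noteq> 0" "v \<noteq> 0" "w \<noteq> 0" using assms by (auto simp: u_def v_def w_def)
  have "1 / u - (1 / v + (m - c) * (1 / w - 1 / v)) =
      (v * w - u * w - (m - c) * (u * v - u * w)) / (u * v * w)"
    using nz by (simp add: field_simps)
  also have "v * w - u * w - (m - c) * (u * v - u * w) = (m - c) * (m - c - 1) * x\<^sup>2"
    unfolding u_def v_def w_def by (simp add: algebra_simps power2_eq_square)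
  finally show ?thesis unfolding u_def v_def w_def .
qed

text \<open>Discrete convexity of \<open>l \<mapsto> 1 / (1 - l * x)\<close>: at integers it lies above the chord through
  \<open>c\<close> and \<open>c + 1\<close>.\<close>

lemma sum_reciprocal_balanced:
  fixes x :: real
  assumes sum: "sum_list ms = length ms * c + t" and t: "t < length ms" and x: "x > 0"
    and pos: "\<And>m. m \<in> set ms \<Longrightarrow> 1 - real m * x > 0"
    and c: "1 - real (c + 1) * x > 0"
  shows "(\<Sum>m\<leftarrow>balanced_lengths (length ms) c t. 1 / (1 - real m * x))
      \<le> (\<Sum>m\<leftarrow>ms. 1 / (1 - real m * x))"
    and "(\<Sum>m\<leftarrow>ms. 1 / (1 - real m * x))
        = (\<Sum>m\<leftarrow>balanced_lengths (length ms) c t. 1 / (1 - real m * x)) \<Longrightarrow>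
      mset ms = mset (balanced_lengths (length ms) c t)"
proof -
  let ?S = "\<Sum>m\<leftarrow>ms. 1 / (1 - real m * x)"
  let ?B = "\<Sum>m\<leftarrow>balanced_lengths (length ms) c t. 1 / (1 - real m * x)"
  define f where "f m = 1 / (1 - real m * x)" for m
  define K where "K = f (c + 1) - f c"
  define e where "e m = f m - (f c + (real m - real c) * K)" for m
  have c': "1 - real c * x > 0" using c x by (simp add: algebra_simps)
  have e_eq: "e m = (real m - real c) * (real m - real c - 1) * x\<^sup>2 /
      ((1 - real m * x) * (1 - real c * x) * (1 - real (c + 1) * x))" if "m \<in> set ms" for m
    using reciprocal_chord_eq[of "real m" x "real c"] pos[OF that] c c'
    by (simp add: e_def K_def f_def add.commute)
  have e0: "0 \<le> e m" if "m \<in> set ms" for m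
  proof -
    have "0 \<le> (real m - real c) * (real m - real c - 1)"
    proof (cases "m \<le> c")
      case True
      thus ?thesis by (intro mult_nonpos_nonpos) auto
    next
      case False
      hence "real m \<ge> real c + 1" by linarith
      thus ?thesis by simp
    qed
    thus ?thesis unfolding e_eq[OF that] using pos[OF that] c c' by simp
  qed
  \<comment> \<open>The chord is affine, so it has the same total over all lists of this length and
    sum, and the entries of the balanced list lie on it.\<close>
  have S: "?S = ?B + (\<Sum>m\<leftarrow>ms. e m)"
  proof -
    have "(\<Sum>m\<leftarrow>ms'. f m) = real (length ms') * f c + (real (sum_list ms') - real (length ms') * real c) * K
        + (\<Sum>m\<leftarrow>ms'. e m)" for ms'
      by (induction ms') (auto simp: e_def algebra_simps)
    from this[of ms] have "(\<Sum>m\<leftarrow>ms. f m) = real (length ms) * f c + real t * K + (\<Sum>m\<leftarrow>ms. e m)"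
      unfolding sum by simp
    also have "real (length ms) * f c + real t * K = real t * f (c + 1) + real (length ms - t) * f c"
      using t by (simp add: K_def algebra_simps of_nat_diff)
    finally show ?thesis unfolding sum_balanced_lengths by (simp add: f_def)
  qed
  have "0 \<le> (\<Sum>m\<leftarrow>ms. e m)" using e0 by (intro sum_list_nonneg) auto
  thus "?B \<le> ?S" using S by simp
  assume "?S = ?B"
  hence "(\<Sum>m\<leftarrow>ms. e m) = 0" using S by simp
  hence ez: "e m = 0" if "m \<in> set ms" for m
    using sum_list_nonneg_eq_0_iff[of "map e ms"] e0 that by auto
  have "m \<in> {c, c + 1}" if "m \<in> set ms" for m
  proof -
    have "(real m - real c) * (real m - real c - 1) = 0"
      using ez[OF that] x pos[OF that] c c' unfolding e_eq[OF that] by auto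
    hence "real m = real c \<or> real m = real (c + 1)"
      by (simp only: mult_eq_0_iff) (auto simp: algebra_simps)
    thus ?thesis by (simp only: of_nat_eq_iff) simp
  qed
  thus "mset ms = mset (balanced_lengths (length ms) c t)"
    using balanced_lengths_mset_eq[of ms c t] sum t by blast
qed

lemma sum_list_le_length_mult:
  fixes ms :: "nat list"
  shows "(\<And>m. m \<in> set ms \<Longrightarrow> m \<le> r) \<Longrightarrow> sum_list ms \<le> length ms * r"
  by (induction ms) (auto simp: add_mono)

lemma sum_list_upper_bound_tight:
  fixes ms :: "nat list"
  assumes "\<And>m. m \<in> set ms \<Longrightarrow> m \<le> r" "length ms * r \<le> sum_list ms"
  shows "ms = replicate (length ms) r"
  using assms
proof (induction ms)
  case (Cons m ms)
  have "sum_list ms \<le> length ms * r" "m \<le> r"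
    using sum_list_le_length_mult[of ms r] Cons.prems(1) by auto
  hence "m = r" "length ms * r \<le> sum_list ms" using Cons.prems(2) by auto
  thus ?case using Cons by simp
qed simp

text \<open>For \<open>a1 + a2\<close> fixed the two terms add up to \<open>(2 - (a1 + a2) * x) / P\<close>, where
  \<open>P = (1 - a1 * x) * (1 - a2 * x)\<close> is negative and decreases as \<open>a1\<close> and \<open>a2\<close> move apart.\<close>

lemma two_longest_reciprocals:
  fixes x :: real
  assumes sum: "a1 + a2 = 2 * r + 1" and "a2 \<le> r" and x: "x > 0"
    and neg: "1 - real (r + 1) * x < 0" and pos: "1 - real r * x > 0"
    and s: "1 / (1 - real (r + 1) * x) + 1 / (1 - real r * x) < 0"
  shows "1 / (1 - real (r + 1) * x) + 1 / (1 - real r * x)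
      \<le> 1 / (1 - real a1 * x) + 1 / (1 - real a2 * x)"
    and "1 / (1 - real a1 * x) + 1 / (1 - real a2 * x)
        = 1 / (1 - real (r + 1) * x) + 1 / (1 - real r * x) \<Longrightarrow> a2 = r"
proof -
  let ?R = "1 / (1 - real (r + 1) * x) + 1 / (1 - real r * x)"
  let ?A = "1 / (1 - real a1 * x) + 1 / (1 - real a2 * x)"
  define k where "k = r - a2"
  have a: "real a1 = real r + 1 + real k" "real a2 = real r - real k"
    using sum assms(2) by (auto simp: k_def)
  define P where "P = (1 - real (r + 1) * x) * (1 - real r * x)"
  define Q where "Q = (1 - real a1 * x) * (1 - real a2 * x)"
  define N where "N = 2 - (2 * real r + 1) * x"
  have P: "P < 0" unfolding P_def using neg pos by (rule mult_neg_pos)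
  have QP: "Q = P - real k * (real k + 1) * x\<^sup>2"
    unfolding Q_def P_def a by (simp add: algebra_simps power2_eq_square)
  have Qle: "Q \<le> P" unfolding QP using x by simp
  have R: "?R = N / P" using neg pos by (simp add: P_def N_def add_frac_eq algebra_simps)
  have "Q < 0" using Qle P by linarith
  hence "1 - real a1 * x \<noteq> 0" "1 - real a2 * x \<noteq> 0" unfolding Q_def by auto
  hence A: "?A = N / Q"
    by (simp add: Q_def N_def a add_frac_eq algebra_simps)
  \<comment> \<open>\<open>N / P\<close> and \<open>P\<close> are both negative, so \<open>N\<close>
    is positive, and a more negative denominator raises the quotient.\<close>
  have N: "N > 0" using s P unfolding R by (simp add: divide_less_0_iff)
  show "?R \<le> ?A" unfolding R A using N P \<open>Q < 0\<close> Qle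
    by (simp add: divide_simps mult_left_mono)
  assume "?A = ?R"
  hence "Q = P" unfolding R A using N P \<open>Q < 0\<close> by (simp add: divide_simps)
  hence "real k * (real k + 1) * x\<^sup>2 = 0" using QP by simp
  hence "k = 0" using x by auto
  thus "a2 = r" using assms(2) by (simp add: k_def)
qed

definition AS_lengths :: "nat \<Rightarrow> nat \<Rightarrow> nat \<Rightarrow> nat \<Rightarrow> nat list" where
  "AS_lengths r q c t = (r + 1) # r # balanced_lengths q c t"

lemma AS_eq_spider: "AS r (q + 2) c t = spider (AS_lengths r q c t)"
  by (simp add: AS_def AS_lengths_def balanced_lengths_def)

lemma secular_AS_lengths:
  "secular (AS_lengths r q c t) x = 1 / (1 - real (r + 1) * x) + 1 / (1 - real r * x)
     + real t / (1 - real (c + 1) * x) + real (q - t) / (1 - real c * x)"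
  unfolding AS_lengths_def secular_def
  by (simp add: sum_balanced_lengths)

text \<open>The two longest terms and the short ones are compared separately at the same point, each
  part being smallest for \<open>AS\<close>. A vanishing total therefore forces equality in both
  parts.\<close>

lemma secular_AS_minimal:
  fixes x :: real
  assumes sum: "a1 + a2 = 2 * r + 1" and a2: "a2 \<le> r" and ms: "\<And>m. m \<in> set ms \<Longrightarrow> m \<le> r"
    and sum_ms: "sum_list ms = length ms * c + t" and t: "t < length ms" and x: "x > 0"
    and neg: "1 - real (r + 1) * x < 0" and pos: "1 - real r * x > 0"
    and root: "secular (AS_lengths r (length ms) c t) x = 0"
  shows "0 \<le> secular (a1 # a2 # ms) x"
    and "secular (a1 # a2 # ms) x = 0 \<Longrightarrow>
      mset (a1 # a2 # ms) = mset (AS_lengths r (length ms) c t)"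
proof -
  let ?f = "\<lambda>m. 1 / (1 - real m * x)"
  let ?B = "balanced_lengths (length ms) c t"
  have le: "1 - real m * x > 0" if "m \<le> r" for m
  proof -
    have "real m * x \<le> real r * x" using that x by simp
    thus ?thesis using pos by simp
  qed
  have pos_ms: "1 - real m * x > 0" if "m \<in> set ms" for m using le ms[OF that] by blast
  have bal: "(\<Sum>m\<leftarrow>?B. ?f m) \<le> (\<Sum>m\<leftarrow>ms. ?f m) \<and>
      ((\<Sum>m\<leftarrow>ms. ?f m) = (\<Sum>m\<leftarrow>?B. ?f m) \<longrightarrow> mset ms = mset ?B)"
  proof (cases "c + 1 \<le> r")
    case True
    thus ?thesis using sum_reciprocal_balanced[OF sum_ms t x pos_ms le[OF True]] by blast
  next
    case False
    hence "length ms * r \<le> length ms * c" by simp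
    hence "length ms * r \<le> sum_list ms" using sum_ms by linarith
    hence eq: "ms = replicate (length ms) r" using sum_list_upper_bound_tight ms by blast
    have "sum_list ms = length ms * r" by (subst eq) (simp add: sum_list_replicate)
    hence "length ms * r = length ms * c + t" using sum_ms by simp
    moreover have "r \<le> c" using False by simp
    ultimately have "t = 0" "length ms * r = length ms * c"
      using \<open>length ms * r \<le> length ms * c\<close> by auto
    hence "t = 0" "c = r" using t by auto
    hence "?B = ms" using eq by (simp add: balanced_lengths_def)
    thus ?thesis by simp
  qed
  have "0 < (\<Sum>m\<leftarrow>ms. ?f m)"
    using sum_list_strict_mono[of ms "\<lambda>_. 0" ?f] pos_ms t by (cases ms) auto
  have split: "secular (AS_lengths r (length ms) c t) x
      = (?f (r + 1) + ?f r) + (\<Sum>m\<leftarrow>?B. ?f m)"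
    by (simp add: AS_lengths_def secular_def)
  \<comment> \<open>At the root, a positive contribution of the short branches makes the two longest
    terms of \<open>AS\<close> add up to a negative number, as their comparison requires.\<close>
  have Bpos: "0 < (\<Sum>m\<leftarrow>?B. ?f m)"
  proof -
    have "c \<le> r"
    proof (rule ccontr)
      assume "\<not> c \<le> r"
      hence "length ms * (r + 1) \<le> length ms * c" by (intro mult_left_mono) auto
      hence "length ms * r < sum_list ms" using sum_ms t by simp
      thus False using sum_list_le_length_mult[of ms r] ms by force
    qed
    moreover have "t = 0 \<or> c + 1 \<le> r"
    proof (rule ccontr)
      assume "\<not> (t = 0 \<or> c + 1 \<le> r)"
      hence "t > 0" "c = r" using \<open>c \<le> r\<close> by auto
      hence "length ms * r < sum_list ms" using sum_ms by simp
      thus False using sum_list_le_length_mult[of ms r] ms by force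
    qed
    ultimately have "1 - real m * x > 0" if "m \<in> set ?B" for m
      using that le by (auto simp: balanced_lengths_def split: if_splits)
    moreover have "?B \<noteq> []" using t by (auto simp: balanced_lengths_def)
    ultimately show ?thesis using sum_list_strict_mono[of ?B "\<lambda>_. 0" ?f] by simp
  qed
  hence "?f (r + 1) + ?f r < 0" using root split by simp
  note two = two_longest_reciprocals[OF sum a2 x neg pos this]
  have split': "secular (a1 # a2 # ms) x = (?f a1 + ?f a2) + (\<Sum>m\<leftarrow>ms. ?f m)"
    by (simp add: secular_def)
  show "0 \<le> secular (a1 # a2 # ms) x" using two(1) bal root split split' by linarith
  assume "secular (a1 # a2 # ms) x = 0"
  hence "?f a1 + ?f a2 = ?f (r + 1) + ?f r" "(\<Sum>m\<leftarrow>ms. ?f m) = (\<Sum>m\<leftarrow>?B. ?f m)"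
    using two(1) bal root split split' by linarith+
  hence "a2 = r" "mset ms = mset ?B" using two(2) bal by auto
  thus "mset (a1 # a2 # ms) = mset (AS_lengths r (length ms) c t)"
    using sum by (simp add: AS_lengths_def)
qed

subsection \<open>Spiders of odd diameter\<close>

text \<open>Strictness of \<open>a2 < a1\<close> leaves room between the two poles, and there
  exactly one term of the secular function is negative.\<close>

lemma steklov_lambda2_unique_longest:
  assumes "spider_lengths (a1 # a2 # ms)" and "a2 < a1" and "\<And>m. m \<in> set ms \<Longrightarrow> m \<le> a2"
  defines "lam \<equiv> steklov_lambda2 (spider (a1 # a2 # ms))"
  shows "1 / real a1 < lam" and "lam < 1 / real a2" and "secular (a1 # a2 # ms) lam = 0"
proof -
  interpret spider_lengths "a1 # a2 # ms" by fact
  have a2: "0 < a2" using lengths_pos[of a2] by simp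
  obtain x where x: "1 / real a1 < x" "x < 1 / real a2" "secular (a1 # a2 # ms) x = 0"
    using secular_root_exists[OF assms(2) a2 assms(3)] by blast
  have "0 < 1 / real a1" using a2 assms(2) by simp
  hence xpos: "0 < x" using x(1) by linarith
  have "lam = x" unfolding lam_def
  proof (rule steklov_lambda2_spider[OF assms(1) xpos x(3)])
    show "1 - real a1 * x < 0" using x(1) a2 assms(2) by (simp add: field_simps)
    fix l assume "l \<in> set (a2 # ms)"
    hence "real l * x \<le> real a2 * x" using assms(3) xpos by auto
    moreover have "real a2 * x < 1" using x(2) a2 by (simp add: field_simps)
    ultimately show "1 - real l * x > 0" by simp
  qed
  thus "1 / real a1 < lam" "lam < 1 / real a2" "secular (a1 # a2 # ms) lam = 0" using x by auto
qed

lemma secular_strict_mono_unique_longest: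
  assumes "spider_lengths (a1 # a2 # ms)" and "a2 < a1" and "\<And>m. m \<in> set ms \<Longrightarrow> m \<le> a2"
    and "1 / real a1 < x" "x < y" "y < 1 / real a2"
  shows "secular (a1 # a2 # ms) x < secular (a1 # a2 # ms) y"
proof -
  interpret spider_lengths "a1 # a2 # ms" by fact
  have a2: "0 < a2" using lengths_pos[of a2] by simp
  have "0 < 1 / real a1" using a2 assms(2) by simp
  hence xpos: "0 < x" using assms(4) by linarith
  have *: "real a1 * z > 1" "real l * z < 1"
    if "x \<le> z" "z \<le> y" "l \<in> set (a2 # ms)" for z l
  proof -
    have "1 / real a1 < z" "z < 1 / real a2" using that assms(4-6) by auto
    thus "real a1 * z > 1" using a2 assms(2) by (simp add: field_simps)
    have "real l * z \<le> real a2 * z" using assms(3) that xpos by (intro mult_right_mono) auto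
    also have "\<dots> < 1" using \<open>z < 1 / real a2\<close> a2 by (simp add: field_simps)
    finally show "real l * z < 1" .
  qed
  show ?thesis
    using *[of x] *[of y] assms(5) lengths_pos
    by (intro secular_strict_mono) (fastforce simp: Suc_le_eq)+
qed

section \<open>Sorted branch lengths as a canonical form\<close>

lemma spider_with_cong:
  assumes "T \<simeq> U" "simple_graph T" "spider_with b U"
  shows "spider_with b T"
  using assms graph_iso_trans unfolding spider_with_def by blast

lemma spider_with_spider:
  assumes "spider_lengths ls" shows "spider_with (length ls) (spider ls)"
proof -
  interpret spider_lengths ls by fact
  show ?thesis
    unfolding spider_with_def
    using simple_graph_spider two_branches lengths_pos graph_iso_refl by blast
qed

lemma spider_canonical_form:
  assumes "spider_with b T"
  obtains a1 a2 ms where "T \<simeq> spider (a1 # a2 # ms)" "spider_lengths (a1 # a2 # ms)"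
    "a2 \<le> a1" "\<And>m. m \<in> set ms \<Longrightarrow> m \<le> a2" "b = length ms + 2"
    "diameter T = a1 + a2" "card (verts T) = Suc (a1 + a2 + sum_list ms)"
proof -
  obtain ls where ls: "length ls = b" "\<forall>l\<in>set ls. l \<ge> 1" "T \<simeq> spider ls"
    and b: "b \<ge> 2" and T: "simple_graph T"
    using assms unfolding spider_with_def by blast
  define ks where "ks = rev (sort ls)"
  have ks: "mset ls = mset ks" "length ks = b" by (auto simp: ks_def ls(1))
  have desc: "sorted_wrt (\<ge>) ks" unfolding ks_def sorted_wrt_rev by simp
  obtain a1 a2 ms where k: "ks = a1 # a2 # ms"
    using ks(2) b by (metis Suc_le_length_iff numeral_2_eq_2)
  have sl: "spider_lengths ls" using ls b by unfold_locales auto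
  have slk: "spider_lengths ks"
    using ls b ks by unfold_locales (auto simp: ks_def)
  interpret spider_lengths ks by (rule slk)
  have iso: "T \<simeq> spider ks"
    using ls(3) spider_iso_permutation[OF sl ks(1)] by (rule graph_iso_trans)
  have ord: "a2 \<le> a1" "\<And>m. m \<in> set ms \<Longrightarrow> m \<le> a2" using desc by (auto simp: k)
  have "diameter T = a1 + a2"
    using graph_iso_diameter[OF iso T simple_graph_spider]
      diameter_spider[OF slk[unfolded k] ord] by (simp add: k)
  moreover have "card (verts T) = Suc (a1 + a2 + sum_list ms)"
    using graph_iso_card[OF iso] card_verts_spider by (simp add: k)
  ultimately show thesis
    using that[of a1 a2 ms] iso slk ord ks(2) by (simp add: k)
qed

text \<open>The odd diameter excludes \<open>a1 = a2\<close>, hence \<open>a2 \<le> r\<close>, and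
  so no further branch exceeds \<open>r\<close> either.\<close>

lemma spiders_br_canonical_form:
  assumes "T \<in> spiders_br n (2 * r + 1) b"
  obtains a1 a2 ms where "T \<simeq> spider (a1 # a2 # ms)" "spider_lengths (a1 # a2 # ms)"
    "a1 + a2 = 2 * r + 1" "a2 \<le> r" "\<And>m. m \<in> set ms \<Longrightarrow> m \<le> a2" "b = length ms + 2"
    "n = sum_list ms + 2 * r + 2"
proof -
  have T: "spider_with b T" "card (verts T) = n" "diameter T = 2 * r + 1"
    using assms by (auto simp: spiders_br_def)
  from spider_canonical_form[OF T(1)] obtain a1 a2 ms where
    k: "T \<simeq> spider (a1 # a2 # ms)" "spider_lengths (a1 # a2 # ms)" "a2 \<le> a1"
      "\<And>m. m \<in> set ms \<Longrightarrow> m \<le> a2" "b = length ms + 2"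
    and c: "diameter T = a1 + a2" "card (verts T) = Suc (a1 + a2 + sum_list ms)" by metis
  have "a1 + a2 = 2 * r + 1" "n = sum_list ms + 2 * r + 2" using c T by auto
  moreover from this have "a2 \<le> r" using k(3) by linarith
  ultimately show ?thesis using that[of a1 a2 ms] k by blast
qed

section \<open>The spiders \<open>AS\<close> for a fixed number of branches\<close>

locale AS_parameters =
  fixes r M q c t :: nat
  assumes r: "1 \<le> r" and q: "q \<le> M" "M \<le> q * r" and M: "M = q * c + t" and t: "t < q"
begin

text \<open>\<open>q \<le> M\<close> rules out empty branches (\<open>c = 0\<close>).
  \<open>M \<le> q * r\<close> gives \<open>c \<le> r\<close>, strictly if some branch has length
  \<open>c + 1\<close>.\<close>

lemma balanced_lengths_range:
  assumes "m \<in> set (balanced_lengths q c t)" shows "1 \<le> m" "m \<le> r"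
proof -
  have "c \<noteq> 0" using q(1) M t by (cases c) auto
  moreover have "c \<le> r"
    using q(2) M t by (metis add_leD1 less_nat_zero_code mult_le_cancel1 neq0_conv)
  moreover have "c < r" if "t \<noteq> 0"
  proof -
    have "q * c < q * r" using q(2) M that by linarith
    thus ?thesis by simp
  qed
  moreover have "m = c \<or> (m = c + 1 \<and> t \<noteq> 0)"
    using assms by (auto simp: balanced_lengths_def split: if_splits)
  ultimately show "1 \<le> m" "m \<le> r" by auto
qed

lemma spider_lengths_AS: "spider_lengths (AS_lengths r q c t)"
  using r balanced_lengths_range(1) by unfold_locales (auto simp: AS_lengths_def)

lemma AS_mem_spiders_br: "AS r (q + 2) c t \<in> spiders_br (M + 2 * r + 2) (2 * r + 1) (q + 2)"
proof -
  interpret spider_lengths "AS_lengths r q c t" by (rule spider_lengths_AS)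
  have "length (AS_lengths r q c t) = q + 2"
    using t by (simp add: AS_lengths_def balanced_lengths_def)
  hence "spider_with (q + 2) S" using spider_with_spider[OF spider_lengths_AS] by simp
  moreover have "card (verts S) = M + 2 * r + 2"
  proof -
    have "sum_list (balanced_lengths q c t) = t * (c + 1) + (q - t) * c"
      by (simp add: balanced_lengths_def sum_list_replicate)
    also have "\<dots> = (t + (q - t)) * c + t" by (simp add: algebra_simps)
    also have "\<dots> = M" using t M by simp
    finally show ?thesis unfolding card_verts_spider by (simp add: AS_lengths_def)
  qed
  moreover have "diameter S = 2 * r + 1"
    using diameter_spider[OF spider_lengths_AS[unfolded AS_lengths_def]] balanced_lengths_range(2)
    by (simp add: AS_lengths_def)
  ultimately show ?thesis unfolding spiders_br_def AS_eq_spider by blast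
qed

lemma steklov_lambda2_AS:
  defines "lam \<equiv> steklov_lambda2 (AS r (q + 2) c t)"
  shows "1 / real (r + 1) < lam" "lam < 1 / real r" "secular (AS_lengths r q c t) lam = 0"
  using steklov_lambda2_unique_longest[OF spider_lengths_AS[unfolded AS_lengths_def]]
    balanced_lengths_range(2)
  unfolding lam_def AS_eq_spider AS_lengths_def by auto

lemma AS_root_unique:
  assumes "1 / real (r + 1) < x" "x < 1 / real r" "secular (AS_lengths r q c t) x = 0"
  shows "x = steklov_lambda2 (AS r (q + 2) c t)"
proof (rule ccontr)
  let ?lam = "steklov_lambda2 (AS r (q + 2) c t)"
  have mono: "secular (AS_lengths r q c t) y < secular (AS_lengths r q c t) z"
    if "1 / real (r + 1) < y" "y < z" "z < 1 / real r" for y z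
    using secular_strict_mono_unique_longest[OF spider_lengths_AS[unfolded AS_lengths_def]]
      balanced_lengths_range(2) that unfolding AS_lengths_def by auto
  assume "x \<noteq> ?lam"
  thus False
    using mono[of x ?lam] mono[of ?lam x] steklov_lambda2_AS assms by (cases x ?lam rule: linorder_cases) auto
qed

lemma AS_maximal:
  assumes "T \<in> spiders_br (M + 2 * r + 2) (2 * r + 1) (q + 2)"
  shows "steklov_lambda2 T \<le> steklov_lambda2 (AS r (q + 2) c t)"
    and "steklov_lambda2 T = steklov_lambda2 (AS r (q + 2) c t) \<Longrightarrow> T \<simeq> AS r (q + 2) c t"
proof -
  let ?lam = "steklov_lambda2 (AS r (q + 2) c t)"
  obtain a1 a2 ms where iso: "T \<simeq> spider (a1 # a2 # ms)"
    and sl: "spider_lengths (a1 # a2 # ms)" and a: "a1 + a2 = 2 * r + 1" "a2 \<le> r"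
    and ms: "\<And>m. m \<in> set ms \<Longrightarrow> m \<le> a2" and "q + 2 = length ms + 2"
    and "M + 2 * r + 2 = sum_list ms + 2 * r + 2"
    using spiders_br_canonical_form[OF assms] by metis
  hence len: "q = length ms" and sum: "M = sum_list ms" by simp_all
  interpret spider_lengths "a1 # a2 # ms" by (rule sl)
  have a2: "0 < a2" "a2 < a1" "r + 1 \<le> a1" using lengths_pos[of a2] a by auto
  have mu: "steklov_lambda2 T = steklov_lambda2 S"
    using iso uniquely_harmonic_spider by (rule graph_iso_steklov_lambda2)
  note root = steklov_lambda2_unique_longest[OF sl a2(2) ms]
  note lam = steklov_lambda2_AS
  \<comment> \<open>Moving the two longest lengths apart only widens the interval between the poles,
    so \<open>?lam\<close> lies in the interval of the competitor too.\<close>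
  have "1 / real a1 \<le> 1 / real (r + 1)" using a2(3) by (intro divide_left_mono) auto
  hence low: "1 / real a1 < ?lam" using lam(1) by linarith
  have "1 / real r \<le> 1 / real a2" using a(2) a2(1) r by (intro divide_left_mono) auto
  hence high: "?lam < 1 / real a2" using lam(2) by linarith
  have "0 < 1 / real (r + 1)" by simp
  hence pos: "0 < ?lam" using lam(1) by linarith
  have neg: "1 - real (r + 1) * ?lam < 0" using lam(1) by (simp add: field_simps)
  have pos_r: "1 - real r * ?lam > 0" using lam(2) r by (simp add: field_simps)
  have ms_r: "m \<le> r" if "m \<in> set ms" for m using ms[OF that] a(2) by simp
  have sum_ms: "sum_list ms = length ms * c + t" using M sum len by simp
  have t': "t < length ms" using t len by simp
  have root_lam: "secular (AS_lengths r (length ms) c t) ?lam = 0" using lam(3) by (simp add: len)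
  note minimal = secular_AS_minimal[OF a ms_r sum_ms t' pos neg pos_r root_lam]
  show "steklov_lambda2 T \<le> ?lam"
  proof (rule ccontr)
    assume "\<not> steklov_lambda2 T \<le> ?lam"
    \<comment> \<open>A larger eigenvalue of \<open>T\<close> would be a root to the right of
      \<open>?lam\<close>, so the increasing secular function would be negative at
      \<open>?lam\<close>.\<close>
    hence "secular (a1 # a2 # ms) ?lam < secular (a1 # a2 # ms) (steklov_lambda2 S)"
      using secular_strict_mono_unique_longest[OF sl a2(2) ms low _ root(2)] mu by simp
    thus False using minimal(1) root(3) by (simp add: mu)
  qed
  assume "steklov_lambda2 T = ?lam"
  hence "secular (a1 # a2 # ms) ?lam = 0" using root(3) mu by simp
  hence "mset (a1 # a2 # ms) = mset (AS_lengths r q c t)"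
    using minimal(2) by (simp add: len)
  hence "S \<simeq> AS r (q + 2) c t"
    unfolding AS_eq_spider by (rule spider_iso_permutation[OF sl])
  with iso show "T \<simeq> AS r (q + 2) c t" by (rule graph_iso_trans)
qed

end

section \<open>Change of vertex type, the case of the path, and the maximum over all
  \<open>q\<close>\<close>

lemma spiders_br_copy:
  fixes S :: "'b ugraph"
  assumes "S \<in> spiders_br n D b"
  shows "\<exists>T :: 'a::infinite ugraph. T \<in> spiders_br n D b \<and> T \<simeq> S"
proof -
  have S: "simple_graph S" "spider_with b S" "card (verts S) = n" "diameter S = D"
    using assms by (auto simp: spiders_br_def spider_with_def)
  obtain T :: "'a ugraph" where T: "simple_graph T" "T \<simeq> S"
    using graph_iso_copy[OF S(1)] by blast
  have "T \<in> spiders_br n D b"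
    using spider_with_cong[OF T(2,1) S(2)] graph_iso_card[OF T(2)]
      graph_iso_diameter[OF T(2,1) S(1)] S by (simp add: spiders_br_def)
  thus ?thesis using T(2) by blast
qed

lemma spiders_eq_Union: "spiders n D = (\<Union>b. spiders_br n D b)"
  by (auto simp: spiders_def spiders_br_def)

lemma simple_graph_path_graph: "simple_graph (path_graph m)"
  by (auto simp: simple_graph_def path_graph_def)

lemma path_graph_mem_spiders:
  assumes "1 \<le> r" shows "path_graph (2 * r + 2) \<in> spiders (2 * r + 2) (2 * r + 1)"
proof -
  have iso: "path_graph (2 * r + 2) \<simeq> spider [r + 1, r]"
    using path_graph_iso_spider[of "r + 1" r] assms by (simp add: mult_2)
  interpret spider_lengths "[r + 1, r]" using assms by unfold_locales auto
  have "spider_with 2 S"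
    using spider_with_spider[OF spider_lengths_axioms] by (simp add: numeral_2_eq_2)
  moreover have "card (verts S) = 2 * r + 2" unfolding card_verts_spider by simp
  moreover have "diameter S = 2 * r + 1"
    using diameter_spider[OF spider_lengths_axioms] by simp
  ultimately show ?thesis
    using spider_with_cong[OF iso simple_graph_path_graph] graph_iso_card[OF iso]
      graph_iso_diameter[OF iso simple_graph_path_graph simple_graph_spider]
    by (auto simp: spiders_def)
qed

text \<open>The two longest branches already use up all vertices, so there is no third one. However
  their lengths split, gluing them at the centre gives the same path.\<close>

lemma spiders_path_unique:
  assumes "T \<in> spiders (2 * r + 2) (2 * r + 1)"
  shows "T \<simeq> path_graph (2 * r + 2)"
proof -
  obtain b where "T \<in> spiders_br (2 * r + 2) (2 * r + 1) b"
    using assms unfolding spiders_eq_Union by blast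
  then obtain a1 a2 ms where iso: "T \<simeq> spider (a1 # a2 # ms)"
    and sl: "spider_lengths (a1 # a2 # ms)" and a: "a1 + a2 = 2 * r + 1"
    and n: "2 * r + 2 = sum_list ms + 2 * r + 2"
    using spiders_br_canonical_form by metis
  interpret spider_lengths "a1 # a2 # ms" by (rule sl)
  have pos: "1 \<le> a1" "1 \<le> a2" "\<And>m. m \<in> set ms \<Longrightarrow> 1 \<le> m" using lengths_pos by simp_all
  have "sum_list ms = 0" using n by simp
  hence "ms = []" using pos(3) by (cases ms) force+
  moreover have "path_graph (2 * r + 2) \<simeq> spider [a1, a2]"
    using path_graph_iso_spider[OF pos(1,2)] a by simp
  ultimately show ?thesis using iso graph_iso_sym graph_iso_trans by blast
qed

lemma nat_ceiling_divide_le_iff: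
  "0 < r \<Longrightarrow> nat \<lceil>real M / real r\<rceil> \<le> q \<longleftrightarrow> M \<le> q * r"
  by (simp add: nat_le_iff ceiling_le_iff divide_le_eq flip: of_nat_mult)

text \<open>The \<open>q\<close> branches besides the two longest have lengths between 1 and
  \<open>r\<close> and total \<open>M\<close>, so every spider falls under some \<open>q\<close> in
  the range and is bounded by \<open>AS\<close> for that \<open>q\<close>. A copy of the best
  \<open>AS\<close> attains the bound.\<close>

lemma steklov_lambda2_image_spiders_maximum:
  fixes r M :: nat
  assumes "1 \<le> r" "1 \<le> M"
  shows "is_maximum
     (MAX q \<in> {nat \<lceil>real M / real r\<rceil>..M}. steklov_lambda2 (AS r (q + 2) (M div q) (M mod q)))
     (steklov_lambda2 ` (spiders (M + 2 * r + 2) (2 * r + 1) :: 'a::infinite ugraph set))"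
proof -
  let ?n = "M + 2 * r + 2" and ?D = "2 * r + 1"
  let ?Q = "{nat \<lceil>real M / real r\<rceil>..M}"
  let ?f = "\<lambda>q. steklov_lambda2 (AS r (q + 2) (M div q) (M mod q))"
  have Q: "q \<in> ?Q \<longleftrightarrow> q \<le> M \<and> M \<le> q * r" for q
    using nat_ceiling_divide_le_iff[of r M q] assms(1) by auto
  have par: "AS_parameters r M q (M div q) (M mod q)" if "q \<in> ?Q" for q
  proof -
    have "0 < q" using that assms(2) unfolding Q by (cases q) auto
    thus ?thesis using that assms(1) unfolding Q by unfold_locales auto
  qed
  have "M \<in> ?Q" unfolding Q using assms by simp
  hence ne: "?Q \<noteq> {}" by blast
  have "Max (?f ` ?Q) \<in> ?f ` ?Q" using ne by (intro Max_in) auto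
  then obtain q where qQ: "q \<in> ?Q" and max: "Max (?f ` ?Q) = ?f q" by blast
  interpret AS_parameters r M q "M div q" "M mod q" using qQ by (rule par)
  obtain T :: "'a ugraph" where T: "T \<in> spiders_br ?n ?D (q + 2)"
    "T \<simeq> AS r (q + 2) (M div q) (M mod q)"
    using spiders_br_copy[OF AS_mem_spiders_br] by blast
  have lam_T: "steklov_lambda2 T = ?f q"
    using T(2) spider_lengths.uniquely_harmonic_spider[OF spider_lengths_AS]
    unfolding AS_eq_spider by (rule graph_iso_steklov_lambda2)
  have "T \<in> spiders ?n ?D" using T(1) unfolding spiders_eq_Union by blast
  hence mem: "Max (?f ` ?Q) \<in> steklov_lambda2 ` (spiders ?n ?D :: 'a ugraph set)"
    by (rule image_eqI[where f = steklov_lambda2, OF trans[OF max lam_T[symmetric]]])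
  have "steklov_lambda2 T' \<le> Max (?f ` ?Q)" if T': "T' \<in> (spiders ?n ?D :: 'a ugraph set)" for T'
  proof -
    obtain b where b: "T' \<in> spiders_br ?n ?D b" using T' unfolding spiders_eq_Union by blast
    obtain a1 a2 ms where sl: "spider_lengths (a1 # a2 # ms)" and a2: "a2 \<le> r"
      and ms: "\<And>m. m \<in> set ms \<Longrightarrow> m \<le> a2" and blen: "b = length ms + 2"
      and "?n = sum_list ms + 2 * r + 2"
      using spiders_br_canonical_form[OF b] by metis
    hence sum: "M = sum_list ms" by simp
    have lower: "length xs \<le> sum_list xs" if "\<And>m. m \<in> set xs \<Longrightarrow> 1 \<le> m" for xs :: "nat list"
      using that by (induction xs) (fastforce simp: Suc_le_eq)+
    have "length ms \<le> M" unfolding sum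
      using spider_lengths.lengths_pos[OF sl] by (intro lower) simp
    moreover have "M \<le> length ms * r"
      unfolding sum using ms a2 by (intro sum_list_le_length_mult) (meson le_trans)
    ultimately have inQ: "length ms \<in> ?Q" unfolding Q by blast
    have "steklov_lambda2 T' \<le> ?f (length ms)"
      by (rule AS_parameters.AS_maximal(1)[OF par[OF inQ] b[unfolded blen]])
    also have "\<dots> \<le> Max (?f ` ?Q)" using inQ by (intro Max_ge) auto
    finally show ?thesis .
  qed
  thus ?thesis unfolding is_maximum_def using mem by blast
qed

theorem theorem2p5:
  fixes r D n M :: nat
  assumes "D = 2 * r + 1" and "D \<ge> 3" and "n \<ge> D + 1" and "M = n - 2 * r - 2"
  shows
    "(M = 0 \<longrightarrow>
        path_graph (D + 1) \<in> spiders n D \<and>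
        (\<forall>T \<in> (spiders n D :: 'a::infinite ugraph set). T \<simeq> path_graph (D + 1))) \<and>
     (M \<ge> 1 \<longrightarrow>
        is_maximum
          (MAX q \<in> {nat \<lceil>real M / real r\<rceil>..M}.
             steklov_lambda2 (AS r (q + 2) (M div q) (M mod q)))
          (steklov_lambda2 ` (spiders n D :: 'a ugraph set)) \<and>
        (\<forall>q c t :: nat. nat \<lceil>real M / real r\<rceil> \<le> q \<and> q \<le> M \<and> M = q * c + t \<and> t < q \<longrightarrow>
           AS r (q + 2) c t \<in> spiders_br n D (q + 2) \<and>
           (\<forall>T \<in> (spiders_br n D (q + 2) :: 'a ugraph set).
              steklov_lambda2 T \<le> steklov_lambda2 (AS r (q + 2) c t) \<and>
              (steklov_lambda2 T = steklov_lambda2 (AS r (q + 2) c t) \<longrightarrow>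
                 T \<simeq> AS r (q + 2) c t)) \<and>
           (let F = (\<lambda>x :: real.
                  1 / (1 - real (r + 1) * x) + 1 / (1 - real r * x)
                  + real t / (1 - real (c + 1) * x) + real (q - t) / (1 - real c * x));
                lam = steklov_lambda2 (AS r (q + 2) c t);
                I = {1 / real (r + 1) <..< 1 / real r}
            in lam \<in> I \<and> F lam = 0 \<and> (\<forall>x\<in>I. F x = 0 \<longrightarrow> x = lam))))"
proof (intro conjI impI)
  have r: "1 \<le> r" using assms by linarith
  have n: "n = M + 2 * r + 2" using assms by linarith
  {
    assume "M = 0"
    hence nD: "n = 2 * r + 2" "D + 1 = 2 * r + 2" using n assms(1) by auto
    show "path_graph (D + 1) \<in> spiders n D"
      using path_graph_mem_spiders[OF r] unfolding nD assms(1) by simp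
    show "\<forall>T \<in> (spiders n D :: 'a ugraph set). T \<simeq> path_graph (D + 1)"
      using spiders_path_unique unfolding nD assms(1) by auto
  }
  assume "M \<ge> 1"
  thus "is_maximum
      (MAX q \<in> {nat \<lceil>real M / real r\<rceil>..M}.
         steklov_lambda2 (AS r (q + 2) (M div q) (M mod q)))
      (steklov_lambda2 ` (spiders n D :: 'a ugraph set))"
    unfolding n assms(1) using r by (intro steklov_lambda2_image_spiders_maximum)
  show "\<forall>q c t :: nat. nat \<lceil>real M / real r\<rceil> \<le> q \<and> q \<le> M \<and> M = q * c + t \<and> t < q \<longrightarrow>
     AS r (q + 2) c t \<in> spiders_br n D (q + 2) \<and>
     (\<forall>T \<in> (spiders_br n D (q + 2) :: 'a ugraph set).
        steklov_lambda2 T \<le> steklov_lambda2 (AS r (q + 2) c t) \<and>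
        (steklov_lambda2 T = steklov_lambda2 (AS r (q + 2) c t) \<longrightarrow>
           T \<simeq> AS r (q + 2) c t)) \<and>
     (let F = (\<lambda>x :: real.
            1 / (1 - real (r + 1) * x) + 1 / (1 - real r * x)
            + real t / (1 - real (c + 1) * x) + real (q - t) / (1 - real c * x));
          lam = steklov_lambda2 (AS r (q + 2) c t);
          I = {1 / real (r + 1) <..< 1 / real r}
      in lam \<in> I \<and> F lam = 0 \<and> (\<forall>x\<in>I. F x = 0 \<longrightarrow> x = lam))"
  proof (intro allI impI)
    fix q c t :: nat
    assume q: "nat \<lceil>real M / real r\<rceil> \<le> q \<and> q \<le> M \<and> M = q * c + t \<and> t < q"
    have "nat \<lceil>real M / real r\<rceil> \<le> q \<longleftrightarrow> M \<le> q * r"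
      using r by (intro nat_ceiling_divide_le_iff) simp
    hence "M \<le> q * r" using q by blast
    then interpret AS_parameters r M q c t using q r by unfold_locales auto
    show "AS r (q + 2) c t \<in> spiders_br n D (q + 2) \<and>
      (\<forall>T \<in> (spiders_br n D (q + 2) :: 'a ugraph set).
        steklov_lambda2 T \<le> steklov_lambda2 (AS r (q + 2) c t) \<and>
        (steklov_lambda2 T = steklov_lambda2 (AS r (q + 2) c t) \<longrightarrow>
           T \<simeq> AS r (q + 2) c t)) \<and>
      (let F = (\<lambda>x :: real.
            1 / (1 - real (r + 1) * x) + 1 / (1 - real r * x)
            + real t / (1 - real (c + 1) * x) + real (q - t) / (1 - real c * x));
          lam = steklov_lambda2 (AS r (q + 2) c t);
          I = {1 / real (r + 1) <..< 1 / real r}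
       in lam \<in> I \<and> F lam = 0 \<and> (\<forall>x\<in>I. F x = 0 \<longrightarrow> x = lam))"
      \<comment> \<open>Folds the displayed equation back into \<open>secular\<close>.\<close>
      unfolding Let_def secular_AS_lengths[symmetric] n assms(1)
    proof (intro conjI ballI impI)
      show "AS r (q + 2) c t \<in> spiders_br (M + 2 * r + 2) (2 * r + 1) (q + 2)"
        by (rule AS_mem_spiders_br)
      show "steklov_lambda2 (AS r (q + 2) c t) \<in> {1 / real (r + 1) <..< 1 / real r}"
        using steklov_lambda2_AS(1,2) by (simp only: greaterThanLessThan_iff)
    qed (use AS_maximal steklov_lambda2_AS(3) AS_root_unique in
        \<open>simp_all only: greaterThanLessThan_iff\<close>)
  qed
qed

end
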